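(* Let $\lambda$ be a frequency and $k\ge0$. There exists $C>0$ such that, for all $D\in\mathcal D^{\mathrm{ext}}_{\infty,k}(\lambda)$, $$|a_n(D)|\le C\,\|D\|_{\mathcal D^{\mathrm{ext}}_{\infty,k}(\lambda)}\left(\frac1{\varepsilon_n}\right)^k,\qquad n\in\mathbb N.$$
   Context: $\mathbb N=\{1,2,\dots\}$ and $\mathbb C_\theta=\{s\in\mathbb C:\operatorname{Re}s>\theta\}$. A frequency is a strictly increasing sequence $\lambda=(\lambda_n)_{n\in\mathbb N}$ of non-negative reals tending to infinity. Put $\varepsilon_1=\min\{1,\lambda_2-\lambda_1\}$ and $\varepsilon_n=\min\{1,\lambda_n-\lambda_{n-1},\lambda_{n+1}-\lambda_n\}$ for $n\ge2$. $\mathcal D(\lambda)$ is the space of all formal $\lambda$-Dirichlet series $D=\sum_{n=1}^\infty a_n(D)e^{-\lambda_n s}$ with $a_n(D)\in\mathbb C$. For real $l\ge0$, $x>0$ and $s\in\mathbb C$ let $$R^{\lambda,l}_x(D)(s)=\sum_{\lambda_n\le x}a_n(D)\left(1-\frac{\lambda_n}{x}\right)^l e^{-\lambda_n s}$$ (with $0^0=1$). $D$ is $(\lambda,l)$-summable at $s$ if $\lim_{x\to\infty}R^{\lambda,l}_x(D)(s)$ exists. Put $\sigma^{\lambda,l}(D)=\inf\{\sigma\in\mathbb R: D\text{ is }(\lambda,l)\text{-summable at }\sigma\}$ (infimum in $[-\infty,\infty]$). It is known that $(\lambda,l)$-summability at $s_0$ implies $(\lambda,l)$-summability on $\mathbb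 C_{\operatorname{Re}s_0}$ with holomorphic limit function, and that $(\lambda,l)$-summability implies $(\lambda,l')$-summability to the same limit for $l'\ge l$. For $k\ge0$, $\mathcal D^{\mathrm{ext}}_{\infty,k}(\lambda)$ is the space of all $D\in\mathcal D(\lambda)$ for which there is $l\ge0$ with $\sigma^{\lambda,l}(D)<\infty$ such that the limit function $f(s)=\lim_{x\to\infty}R^{\lambda,l}_x(D)(s)$, $s\in\mathbb C_{\sigma^{\lambda,l}(D)}$, has a holomorphic extension to $\mathbb C_0$, again denoted $f=f_D$ (it does not depend on $l$), satisfying $$\|D\|_{\mathcal D^{\mathrm{ext}}_{\infty,k}(\lambda)}:=\sup_{s\in\mathbb C_0}\frac{|f_D(s)|}{(1+|s|)^k}<\infty.$$ *)

theory Defs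
  imports "HOL-Complex_Analysis.Complex_Analysis"
begin

text \<open>
  Sequences are indexed by the positive integers. They are modelled by functions on type nat
  whose value at index 0 is never used: every notion below only inspects indices n >= 1.
  A formal Dirichlet series over a frequency is identified with its sequence of coefficients.
\<close>

definition frequency :: "(nat \<Rightarrow> real) \<Rightarrow> bool" where
  "frequency lam \<longleftrightarrow>
     (\<forall>n\<ge>1. 0 \<le> lam n) \<and> strict_mono_on {1..} lam \<and> filterlim lam at_top sequentially"

definition eps :: "(nat \<Rightarrow> real) \<Rightarrow> nat \<Rightarrow> real" where
  "eps lam n =
     (if n = 1 then min 1 (lam 2 - lam 1)
      else Min {1, lam n - lam (n - 1), lam (n + 1) - lam n})"

type_synonym dirichlet_series = "nat \<Rightarrow> complex"

definition half_plane :: "ereal \<Rightarrow> complex set" where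
  "half_plane \<theta> = {s. \<theta> < ereal (Re s)}"

text \<open>The library has 0 powr 0 = 0, whereas the Riesz means use the convention that 0 to the
  power 0 is 1.\<close>

definition riesz_weight :: "real \<Rightarrow> real \<Rightarrow> real" where
  "riesz_weight l t = (if l = 0 then 1 else t powr l)"

definition riesz_mean ::
  "(nat \<Rightarrow> real) \<Rightarrow> real \<Rightarrow> dirichlet_series \<Rightarrow> real \<Rightarrow> complex \<Rightarrow> complex" where
  "riesz_mean lam l D x s =
     (\<Sum>n | 1 \<le> n \<and> lam n \<le> x.
        D n * of_real (riesz_weight l (1 - lam n / x)) * exp (- of_real (lam n) * s))"

definition riesz_summable ::
  "(nat \<Rightarrow> real) \<Rightarrow> real \<Rightarrow> dirichlet_series \<Rightarrow> complex \<Rightarrow> bool" where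
  "riesz_summable lam l D s \<longleftrightarrow> (\<exists>L. ((\<lambda>x. riesz_mean lam l D x s) \<longlongrightarrow> L) at_top)"

definition riesz_abscissa :: "(nat \<Rightarrow> real) \<Rightarrow> real \<Rightarrow> dirichlet_series \<Rightarrow> ereal" where
  "riesz_abscissa lam l D = Inf {ereal \<sigma> |\<sigma>. riesz_summable lam l D (of_real \<sigma>)}"

text \<open>
  The function f is a holomorphic extension to the right half plane of the limit function of the
  Riesz means of D, for some order l. The abscissa may be negative (or minus infinity), in which
  case being an extension means that f coincides with the limit function on the right half plane.
\<close>

definition is_limit_extension ::
  "(nat \<Rightarrow> real) \<Rightarrow> dirichlet_series \<Rightarrow> (complex \<Rightarrow> complex) \<Rightarrow> bool" where
  "is_limit_extension lam D f \<longleftrightarrow>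
     f holomorphic_on half_plane 0 \<and>
     (\<exists>l\<ge>0. riesz_abscissa lam l D < \<infinity> \<and>
        (\<forall>s \<in> half_plane (riesz_abscissa lam l D) \<inter> half_plane 0.
           ((\<lambda>x. riesz_mean lam l D x s) \<longlongrightarrow> f s) at_top))"

text \<open>
  Such an extension, if there is one, is uniquely determined on the right half plane, also with
  respect to the order l; outside the right half plane the values are arbitrary and never used.
\<close>

definition limit_fun :: "(nat \<Rightarrow> real) \<Rightarrow> dirichlet_series \<Rightarrow> complex \<Rightarrow> complex" where
  "limit_fun lam D = (SOME f. is_limit_extension lam D f)"

definition D_ext :: "(nat \<Rightarrow> real) \<Rightarrow> real \<Rightarrow> dirichlet_series set" where
  "D_ext lam k =
     {D. (\<exists>f. is_limit_extension lam D f) \<and>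
         bdd_above ((\<lambda>s. norm (limit_fun lam D s) / (1 + norm s) powr k) ` half_plane 0)}"

definition D_ext_norm :: "(nat \<Rightarrow> real) \<Rightarrow> real \<Rightarrow> dirichlet_series \<Rightarrow> real" where
  "D_ext_norm lam k D =
     (SUP s \<in> half_plane 0. norm (limit_fun lam D s) / (1 + norm s) powr k)"

end

theory Submission
  imports Defs "HOL-Probability.Sinc_Integral"
begin

text \<open>
  If \<open>\<Phi>\<close> is entire, of exponential type at most one and rapidly decreasing on vertical lines, then
  \<open>s \<mapsto> \<Phi> (\<epsilon> s)\<close> is the Laplace transform of a bump supported in \<open>[-\<epsilon>, \<epsilon>]\<close>. Hence, with
  \<open>\<epsilon> = \<epsilon>\<^sub>n\<close>, integrating a Dirichlet polynomial against \<open>\<Phi> (\<epsilon> s) exp (\<lambda>\<^sub>n s)\<close> along a vertical line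
  retains the \<open>n\<close>-th coefficient alone, because all other frequencies are at distance at least
  \<open>\<epsilon>\<close> from \<open>\<lambda>\<^sub>n\<close>. Applied to the limit function \<open>f\<close> this gives
  \<open>a\<^sub>n \<integral> \<Phi> (i \<epsilon> t) dt = \<integral> f(s) \<Phi> (\<epsilon> s) exp (\<lambda>\<^sub>n s) dt\<close> on a line \<open>Re s = c\<close> far to the right
  (\<open>coefficient_integral_representation\<close>). By Cauchy's theorem and the growth bound on \<open>f\<close> the line
  can be moved to any \<open>Re s = \<delta> > 0\<close>, and letting \<open>\<delta>\<close> tend to zero removes the factor
  \<open>exp (\<lambda>\<^sub>n \<delta>)\<close>. What remains is at most \<open>\<parallel>D\<parallel> \<integral> (1 + \<bar>t\<bar>)\<^sup>k \<bar>\<Phi> (i \<epsilon> t)\<bar> dt\<close>, which is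
  of size \<open>\<epsilon>\<close> to the power \<open>-k-1\<close>, while the mass \<open>\<integral> \<Phi> (i \<epsilon> t) dt\<close> on the left is at least
  \<open>1 / \<epsilon>\<close>. The quotient is the claimed bound (\<open>coefficient_bound\<close>).

  Two points need care. The first is the passage from Dirichlet polynomials to \<open>f\<close>. Riesz means converge
  pointwise, and dominated convergence along the line requires a bound that is uniform in the
  truncation \<open>x\<close> and polynomial in \<open>t\<close>. For integer order this comes from convergence at one
  real point, by writing the multiplication of coefficients with \<open>exp (-\<lambda>\<^sub>m w)\<close> as a convolution
  (\<open>riesz_mean_polynomial_bound\<close>); an arbitrary real order is first raised to an integer one by a
  Beta integral (\<open>riesz_summable_raise_order\<close>).

  The second is uniformity of the constant. The degree of that polynomial depends on the series, so
  the decay demanded of \<open>\<Phi>\<close> does too. The kernel \<open>\<Phi>\<close> is therefore a product of two factors: one of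
  fixed decay, chosen from \<open>k\<close>, which enters the final constant, and one of decay adapted to the series,
  for which the final estimate uses only a pointwise bound by the exponential and the lower bound
  \<open>1/2\<close> on \<open>[-i, i]\<close>. Both factors are powers of a rescaled \<open>sinh z / z\<close>, for which these bounds do not depend on
  the exponent.
\<close>

section \<open>Powers of the hyperbolic sine quotient\<close>

text \<open>The entire continuation of \<open>sinh z / z\<close>: twice this function is the Laplace transform of the indicator of \<open>[-1, 1]\<close>.\<close>
definition shc :: "complex \<Rightarrow> complex" where
  "shc z = (if z = 0 then 1 else sinh z / z)"

lemma shc_holomorphic: "shc holomorphic_on UNIV"
proof -
  have sinh_eq: "(sinh :: complex \<Rightarrow> complex) = (\<lambda>z. (exp z - exp (- z)) / 2)"
    by (rule ext) (rule sinh_field_def)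
  have hol: "(sinh :: complex \<Rightarrow> complex) holomorphic_on UNIV"
    unfolding sinh_eq by (intro holomorphic_intros) auto
  have "(sinh has_field_derivative 1) (at (0::complex))"
    by (rule derivative_eq_intros refl | simp)+
  then have "deriv sinh (0::complex) = 1"
    by (rule DERIV_imp_deriv)
  then show ?thesis
    using pole_lemma_open[OF hol open_UNIV, of 0] unfolding shc_def[abs_def] by (simp cong: if_cong)
qed

lemma norm_sinh_le: "norm (sinh z) \<le> exp \<bar>Re z\<bar>" for z :: complex
proof -
  have "norm (exp z - exp (- z)) \<le> exp (Re z) + exp (- Re z)"
    by (rule order_trans[OF norm_triangle_ineq4]) (simp add: norm_exp_eq_Re)
  also have "\<dots> \<le> 2 * exp \<bar>Re z\<bar>"
  proof -
    have "exp (Re z) \<le> exp \<bar>Re z\<bar>" "exp (- Re z) \<le> exp \<bar>Re z\<bar>" by auto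
    then show ?thesis by linarith
  qed
  finally show ?thesis
    by (simp add: sinh_field_def norm_divide)
qed

text \<open>Mean value inequality between \<open>- z\<close> and \<open>z\<close>, inside the strip where \<open>exp\<close> is bounded by
  \<open>exp \<bar>Re z\<bar>\<close>. This covers small \<open>z\<close>, where the triangle inequality loses the factor \<open>norm z\<close>.\<close>
lemma norm_sinh_le_mult: "norm (sinh z) \<le> exp \<bar>Re z\<bar> * norm z" for z :: complex
proof -
  let ?S = "{w::complex. \<bar>Re w\<bar> \<le> \<bar>Re z\<bar>}"
  have S_eq: "?S = {w. Re w \<le> \<bar>Re z\<bar>} \<inter> {w. Re w \<ge> - \<bar>Re z\<bar>}" by auto
  have "convex ?S"
    unfolding S_eq by (intro convex_Int convex_halfspace_Re_le convex_halfspace_Re_ge)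
  moreover have "(exp has_field_derivative exp w) (at w within ?S)" for w
    by (auto intro!: derivative_eq_intros)
  moreover have "norm (exp w) \<le> exp \<bar>Re z\<bar>" if "w \<in> ?S" for w
    using that by (auto simp: norm_exp_eq_Re)
  ultimately have "norm (exp z - exp (- z)) \<le> exp \<bar>Re z\<bar> * norm (z - (- z))"
    by (rule field_differentiable_bound) auto
  also have "norm (z - (- z)) = 2 * norm z"
    by (metis diff_minus_eq_add mult_2 norm_mult norm_numeral)
  finally show ?thesis
    by (simp add: sinh_field_def norm_divide)
qed

lemma norm_shc_le: "norm (shc z) \<le> exp \<bar>Re z\<bar>"
  using norm_sinh_le_mult[of z] by (auto simp: shc_def norm_divide field_simps)

lemma norm_shc_decay: "norm (shc z) \<le> 2 * exp \<bar>Re z\<bar> / (1 + norm z)"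
proof -
  have "norm (shc z) * norm z \<le> exp \<bar>Re z\<bar>"
    using norm_sinh_le[of z] by (auto simp: shc_def norm_divide)
  with norm_shc_le[of z] have "norm (shc z) * (1 + norm z) \<le> 2 * exp \<bar>Re z\<bar>"
    by (simp add: algebra_simps)
  then show ?thesis
    by (simp add: pos_le_divide_eq add_pos_nonneg)
qed

lemma shc_imaginary: "shc (\<i> * of_real t) = of_real (if t = 0 then 1 else sin t / t)"
proof -
  have "sinh (\<i> * of_real t) = \<i> * of_real (sin t)"
    by (simp add: sinh_field_def exp_Euler cos_of_real sin_of_real exp_minus_Euler)
  then show ?thesis
    by (auto simp: shc_def)
qed

text \<open>The quotient is a value of the cosine at an intermediate point, and \<open>cos z = 1 - 2 sin\<^sup>2 (z / 2)\<close>.\<close>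
lemma sin_over_ge:
  fixes t :: real
  assumes "t \<noteq> 0"
  shows "1 - t\<^sup>2 / 2 \<le> sin t / t"
proof -
  have pos: "1 - t\<^sup>2 / 2 \<le> sin t / t" if "t > 0" for t :: real
  proof -
    have "\<exists>z. 0 < z \<and> z < t \<and> sin t - sin 0 = (t - 0) * cos z"
      by (rule MVT2[OF that]) (auto intro!: derivative_eq_intros)
    then obtain z where z: "0 < z" "z < t" "sin t = t * cos z" by auto
    have "(sin (z / 2))\<^sup>2 \<le> (z / 2)\<^sup>2"
      using abs_sin_x_le_abs_x[of "z / 2"] by (metis abs_le_square_iff)
    moreover have "cos z = 1 - 2 * (sin (z / 2))\<^sup>2"
      using cos_double_sin[of "z / 2"] by simp
    ultimately have "cos z \<ge> 1 - z\<^sup>2 / 2" by (simp add: power_divide)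
    moreover have "z\<^sup>2 \<le> t\<^sup>2" using z by (intro power_mono) auto
    ultimately have "1 - t\<^sup>2 / 2 \<le> cos z" by linarith
    then show ?thesis using z by simp
  qed
  show ?thesis
    using pos[of t] pos[of "- t"] assms by (cases "t > 0") auto
qed

text \<open>Rescaling by the exponent keeps the exponential type equal to one for every \<open>m\<close>. The exponent is
  even so that the kernel is nonnegative on the imaginary axis.\<close>
definition sinc_kernel :: "nat \<Rightarrow> complex \<Rightarrow> complex" where
  "sinc_kernel m z = shc (z / of_nat (2 * m)) ^ (2 * m)"

lemma sinc_kernel_holomorphic:
  assumes "m > 0" "g holomorphic_on S"
  shows "(\<lambda>z. sinc_kernel m (g z)) holomorphic_on S"
proof -
  have "(shc \<circ> (\<lambda>z. g z / of_nat (2 * m))) holomorphic_on S"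
    by (rule holomorphic_on_compose_gen[OF _ shc_holomorphic])
       (use assms in \<open>auto intro!: holomorphic_intros\<close>)
  then show ?thesis
    unfolding sinc_kernel_def by (intro holomorphic_intros) (simp add: o_def)
qed

lemma norm_sinc_kernel_le:
  assumes "m > 0"
  shows "norm (sinc_kernel m z) \<le> exp \<bar>Re z\<bar>"
proof -
  have "norm (sinc_kernel m z) \<le> exp \<bar>Re (z / of_nat (2 * m))\<bar> ^ (2 * m)"
    unfolding sinc_kernel_def norm_power by (intro power_mono norm_shc_le) auto
  also have "\<dots> = exp \<bar>Re z\<bar>"
    using assms by (simp add: exp_of_nat_mult[symmetric] Re_divide_of_nat abs_mult)
  finally show ?thesis .
qed

lemma norm_sinc_kernel_decay:
  assumes "m > 0"
  shows "norm (sinc_kernel m z) \<le> (4 * real m) ^ (2 * m) * exp \<bar>Re z\<bar> / (1 + norm z) ^ (2 * m)"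
proof -
  define w where "w = z / of_nat (2 * m)"
  have w: "norm z = 2 * m * norm w" "\<bar>Re z\<bar> = real (2 * m) * \<bar>Re w\<bar>"
    using assms by (auto simp: w_def norm_divide Re_divide_of_nat abs_mult norm_mult)
  have "norm (shc w) \<le> 2 * exp \<bar>Re w\<bar> / (1 + norm w)"
    by (rule norm_shc_decay)
  also have "\<dots> \<le> 2 * exp \<bar>Re w\<bar> * (2 * m) / (1 + norm z)"
  proof -
    have "1 + norm z \<le> (2 * m) * (1 + norm w)"
      using assms by (simp add: w algebra_simps)
    then have "1 / (1 + norm w) \<le> (2 * m) / (1 + norm z)"
      by (simp add: divide_simps add_pos_nonneg)
    from mult_left_mono[OF this, of "2 * exp \<bar>Re w\<bar>"] show ?thesis by simp
  qed
  finally have "norm (shc w) \<le> 4 * m * exp \<bar>Re w\<bar> / (1 + norm z)"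
    by (simp add: mult_ac)
  then have "norm (shc w) ^ (2 * m) \<le> (4 * m * exp \<bar>Re w\<bar> / (1 + norm z)) ^ (2 * m)"
    by (rule power_mono) auto
  also have "\<dots> = (4 * real m) ^ (2 * m) * exp \<bar>Re z\<bar> / (1 + norm z) ^ (2 * m)"
    by (simp add: power_divide power_mult_distrib w exp_of_nat_mult[symmetric])
  finally show ?thesis
    by (simp add: sinc_kernel_def norm_power w_def)
qed

lemma sinc_kernel_imaginary:
  "\<exists>r::real. sinc_kernel m (\<i> * of_real t) = of_real r \<and> 0 \<le> r"
proof -
  have eq: "\<i> * of_real t / of_nat (2 * m) = \<i> * of_real (t / (2 * m))"
    by simp
  show ?thesis
    unfolding sinc_kernel_def eq shc_imaginary of_real_power[symmetric]
    by (intro exI conjI, rule refl) (simp add: power_mult)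
qed

text \<open>The point is that the lower bound is independent of \<open>m\<close>: each factor is
  \<open>1 - O(1 / m\<^sup>2)\<close>, so by Bernoulli's inequality the product of the \<open>2 m\<close> factors stays away from zero.\<close>
lemma Re_sinc_kernel_ge:
  assumes "m > 0" "\<bar>t\<bar> \<le> 1"
  shows "1 / 2 \<le> Re (sinc_kernel m (\<i> * of_real t))"
proof -
  define u where "u = t / (2 * m)"
  define r where "r = (if u = 0 then 1 else sin u / u)"
  have eq: "\<i> * of_real t / of_nat (2 * m) = \<i> * of_real u"
    by (simp add: u_def)
  have k: "sinc_kernel m (\<i> * of_real t) = of_real (r ^ (2 * m))"
    unfolding sinc_kernel_def eq shc_imaginary r_def by simp
  have u: "u\<^sup>2 \<le> 1 / (2 * real m)\<^sup>2"
    using assms by (simp add: u_def power_divide divide_right_mono abs_square_le_1)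
  have "real m \<ge> 1" using assms by simp
  have m1: "1 \<le> (2 * real m)\<^sup>2"
    using \<open>real m \<ge> 1\<close> by (intro one_le_power) simp
  have r: "r \<ge> 1 - u\<^sup>2 / 2"
    using sin_over_ge[of u] by (auto simp: r_def)
  have "1 / (2 * real m)\<^sup>2 \<le> 1" using m1 assms by simp
  then have u1: "u\<^sup>2 \<le> 1" using u by linarith
  have "1 - (2 * m) * (u\<^sup>2 / 2) \<le> (1 - u\<^sup>2 / 2) ^ (2 * m)"
    using Bernoulli_inequality[of "- (u\<^sup>2 / 2)" "2 * m"] u1 by simp
  also have "\<dots> \<le> r ^ (2 * m)"
    using r u1 by (intro power_mono) auto
  finally have "r ^ (2 * m) \<ge> 1 - m * u\<^sup>2" by simp
  moreover have "m * u\<^sup>2 \<le> 1 / 2"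
  proof -
    have "m * u\<^sup>2 \<le> m * (1 / (2 * real m)\<^sup>2)" using u by (intro mult_left_mono) auto
    also have "\<dots> = 1 / (4 * m)" using assms by (simp add: power2_eq_square)
    also have "\<dots> \<le> 1 / 2" using \<open>real m \<ge> 1\<close> by (simp add: field_simps)
    finally show ?thesis .
  qed
  ultimately show ?thesis by (simp add: k)
qed

section \<open>Integrals along vertical lines\<close>

lemma integrable_inverse_one_plus_square: "integrable lborel (\<lambda>t::real. 1 / (1 + t\<^sup>2))"
  using integrable_inverse_1_plus_square
  by (simp add: set_integrable_def divide_inverse einterval_def)

lemma integrable_dominated_by_inverse_square:
  fixes g :: "real \<Rightarrow> complex"
  assumes "continuous_on UNIV g" "\<And>t. norm (g t) \<le> B / (1 + t\<^sup>2)"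
  shows "integrable lborel g"
proof (rule Bochner_Integration.integrable_bound)
  show "integrable lborel (\<lambda>t. B * (1 / (1 + t\<^sup>2)))"
    by (intro integrable_mult_right integrable_inverse_one_plus_square)
  show "g \<in> borel_measurable lborel"
    using borel_measurable_continuous_onI[OF assms(1)] by simp
  show "AE t in lborel. norm (g t) \<le> norm (B * (1 / (1 + t\<^sup>2)))"
  proof (rule AE_I2)
    fix t :: real
    have "B / (1 + t\<^sup>2) \<le> norm (B * (1 / (1 + t\<^sup>2)))"
      by (simp add: abs_mult divide_right_mono)
    then show "norm (g t) \<le> norm (B * (1 / (1 + t\<^sup>2)))"
      using assms(2)[of t] by linarith
  qed
qed

lemma continuous_on_Complex_line: "continuous_on A (\<lambda>t. Complex a t)"
  unfolding complex_eq_iff Complex_eq by (intro continuous_intros)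

lemma continuous_on_vertical_line:
  assumes "g holomorphic_on S" "\<And>t. Complex a t \<in> S"
  shows "continuous_on UNIV (\<lambda>t. g (Complex a t))"
  by (rule continuous_on_compose2[OF holomorphic_on_imp_continuous_on[OF assms(1)]])
     (use assms(2) continuous_on_Complex_line in auto)

lemma tendsto_integral_symmetric_interval:
  fixes h :: "real \<Rightarrow> complex"
  assumes "integrable lborel h"
  shows "(\<lambda>n::nat. integral {- real n..real n} h) \<longlonglongrightarrow> (LINT t|lborel. h t)"
proof -
  have "(\<lambda>n::nat. LINT t|lborel. indicator {- real n..real n} t *\<^sub>R h t) \<longlonglongrightarrow> (LINT t|lborel. h t)"
  proof (rule integral_dominated_convergence[where w = "\<lambda>t. norm (h t)"])
    show "AE t in lborel. (\<lambda>n. indicator {- real n..real n} t *\<^sub>R h t) \<longlonglongrightarrow> h t"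
    proof (intro AE_I2 tendsto_eventually)
      fix t :: real
      show "\<forall>\<^sub>F n in sequentially. indicator {- real n..real n} t *\<^sub>R h t = h t"
        using eventually_ge_at_top[of "nat \<lceil>\<bar>t\<bar>\<rceil>"]
        by eventually_elim (auto simp: indicator_def)
    qed
  qed (use assms in \<open>auto simp: indicator_def intro!: AE_I2\<close>)
  moreover have "(LINT t|lborel. indicator {- real n..real n} t *\<^sub>R h t) = integral {- real n..real n} h" for n
    using set_borel_integral_eq_integral(2)[of "{- real n..real n}" h] assms
      integrable_mult_indicator[of "{- real n..real n}" lborel h]
    by (simp add: set_integrable_def set_lebesgue_integral_def)
  ultimately show ?thesis by simp
qed

text \<open>Cauchy's theorem for tall rectangles, with a primitive of \<open>g\<close> in place of a contour integral: the
  difference of the integrals over the vertical sides is the difference of the increments of the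
  primitive over the horizontal sides, which have fixed length and lie where \<open>g\<close> is small.\<close>
lemma vertical_line_shift_aux:
  assumes S: "open S" "convex S" and g: "g holomorphic_on S" and "a \<le> b"
    and strip: "\<And>s. a \<le> Re s \<Longrightarrow> Re s \<le> b \<Longrightarrow> s \<in> S \<and> norm (g s) \<le> B / (1 + (Im s)\<^sup>2)"
  shows "(LINT t|lborel. g (Complex a t)) = (LINT t|lborel. g (Complex b t))"
proof -
  obtain F where F: "\<And>s. s \<in> S \<Longrightarrow> (F has_field_derivative g s) (at s within S)"
    using holomorphic_convex_primitive'[OF S(2,1) g] by blast
  have F': "(F has_field_derivative g s) (at s)" if "s \<in> S" for s
    using F[OF that] at_within_open[OF that S(1)] by simp
  have int: "integrable lborel (\<lambda>t. g (Complex c t))" if "a \<le> c" "c \<le> b" for c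
    using that strip[of "Complex c _"]
    by (intro integrable_dominated_by_inverse_square continuous_on_vertical_line[OF g]) auto
  have ftc: "((\<lambda>t. \<i> * g (Complex c t)) has_integral F (Complex c (real n)) - F (Complex c (- real n)))
      {- real n..real n}" if "a \<le> c" "c \<le> b" for c n
  proof (rule fundamental_theorem_of_calculus)
    fix t
    have "((\<lambda>t. Complex c t) has_vector_derivative \<i>) (at t)"
      unfolding Complex_eq by (auto intro!: derivative_eq_intros)
    from field_vector_diff_chain_at[OF this F'] strip[of "Complex c t"] that
    have "((\<lambda>t. F (Complex c t)) has_vector_derivative \<i> * g (Complex c t)) (at t)"
      by (auto simp: o_def)
    then show "((\<lambda>t. F (Complex c t)) has_vector_derivative \<i> * g (Complex c t))
        (at t within {- real n..real n})"
      by (rule has_vector_derivative_at_within)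
  qed simp
  have horizontal: "norm (F (Complex b t) - F (Complex a t)) \<le> B / (1 + t\<^sup>2) * (b - a)" for t
  proof -
    have seg: "a \<le> Re z \<and> Re z \<le> b \<and> Im z = t"
      if "z \<in> closed_segment (Complex a t) (Complex b t)" for z
    proof -
      obtain u where u: "0 \<le> u" "u \<le> 1"
        and z: "z = (1 - u) *\<^sub>R Complex a t + u *\<^sub>R Complex b t"
        using \<open>z \<in> _\<close> unfolding in_segment by blast
      have Re: "Re z = (1 - u) * a + u * b" and Im: "Im z = (1 - u) * t + u * t"
        unfolding z by simp_all
      have "Im z = t" unfolding Im by (simp add: left_diff_distrib)
      moreover have "a \<le> Re z" "Re z \<le> b"
        unfolding Re using convex_bound_le[of a b b "1 - u" u] convex_bound_le[of "- a" "- a" "- b" "1 - u" u] u \<open>a \<le> b\<close>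
        by linarith+
      ultimately show ?thesis by blast
    qed
    have "norm (F (Complex b t) - F (Complex a t)) \<le> B / (1 + t\<^sup>2) * norm (Complex b t - Complex a t)"
    proof (rule field_differentiable_bound[of "closed_segment (Complex a t) (Complex b t)" F g])
      fix z assume z: "z \<in> closed_segment (Complex a t) (Complex b t)"
      have z': "z \<in> S \<and> norm (g z) \<le> B / (1 + (Im z)\<^sup>2)"
        by (rule strip) (use seg[OF z] in blast)+
      show "(F has_field_derivative g z) (at z within closed_segment (Complex a t) (Complex b t))"
        by (rule has_field_derivative_at_within, rule F') (use z' in blast)
      show "norm (g z) \<le> B / (1 + t\<^sup>2)"
        using z' seg[OF z] by metis
    qed (rule convex_closed_segment ends_in_segment)+
    also have "Complex b t - Complex a t = of_real (b - a)"
      by (simp add: complex_eq_iff)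
    also have "norm (of_real (b - a) :: complex) = b - a"
      using \<open>a \<le> b\<close> by (simp only: norm_of_real)
    finally show ?thesis .
  qed
  define h where "h t = g (Complex b t) - g (Complex a t)" for t
  have h: "integrable lborel h"
    unfolding h_def by (rule Bochner_Integration.integrable_diff; rule int) (use \<open>a \<le> b\<close> in auto)
  have bound: "norm (integral {- real n..real n} h) \<le> 2 * B * (b - a) * (1 / (1 + (real n)\<^sup>2))" for n
  proof -
    have "((\<lambda>t. \<i> * g (Complex b t) - \<i> * g (Complex a t)) has_integral
        (F (Complex b (real n)) - F (Complex b (- real n)))
        - (F (Complex a (real n)) - F (Complex a (- real n)))) {- real n..real n}"
      by (intro has_integral_diff ftc) (use \<open>a \<le> b\<close> in auto)
    moreover have "(\<lambda>t. \<i> * g (Complex b t) - \<i> * g (Complex a t)) = (\<lambda>t. \<i> * h t)"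
      by (simp add: h_def right_diff_distrib)
    moreover have "(x - y) - (z - w) = (x - z) - (y - w)" for x y z w :: complex
      by simp
    ultimately have "((\<lambda>t. \<i> * h t) has_integral
        (F (Complex b (real n)) - F (Complex a (real n)))
        - (F (Complex b (- real n)) - F (Complex a (- real n)))) {- real n..real n}"
      by metis
    then have "integral {- real n..real n} (\<lambda>t. \<i> * h t) =
        (F (Complex b (real n)) - F (Complex a (real n)))
        - (F (Complex b (- real n)) - F (Complex a (- real n)))"
      by (rule integral_unique)
    then have "norm (integral {- real n..real n} (\<lambda>t. \<i> * h t)) =
        norm ((F (Complex b (real n)) - F (Complex a (real n)))
        - (F (Complex b (- real n)) - F (Complex a (- real n))))"
      by (rule arg_cong)
    also have "\<dots> \<le> B / (1 + (real n)\<^sup>2) * (b - a) + B / (1 + (real n)\<^sup>2) * (b - a)"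
      by (rule order_trans[OF norm_triangle_ineq4], rule add_mono[OF horizontal])
         (use horizontal[of "- real n"] in simp)
    also have "\<dots> = 2 * B * (b - a) * (1 / (1 + (real n)\<^sup>2))" by simp
    finally show ?thesis by (simp only: integral_mult_right norm_mult norm_ii mult_1)
  qed
  have "(\<lambda>n. 1 / (1 + (real n)\<^sup>2)) \<longlonglongrightarrow> 0"
    by real_asymp
  from tendsto_mult_right_zero[OF this, of "2 * B * (b - a)"]
  have "(\<lambda>n. 2 * B * (b - a) * (1 / (1 + (real n)\<^sup>2))) \<longlonglongrightarrow> 0" .
  then have "(\<lambda>n. integral {- real n..real n} h) \<longlonglongrightarrow> 0"
    by (rule Lim_null_comparison[rotated]) (use bound in \<open>simp only: eventually_sequentially, blast\<close>)
  with tendsto_integral_symmetric_interval[OF h] have "(LINT t|lborel. h t) = 0"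
    using LIMSEQ_unique by blast
  moreover have "(LINT t|lborel. h t) = (LINT t|lborel. g (Complex b t)) - (LINT t|lborel. g (Complex a t))"
    unfolding h_def by (rule Bochner_Integration.integral_diff; rule int) (use \<open>a \<le> b\<close> in auto)
  ultimately show ?thesis by simp
qed

lemma vertical_line_shift:
  assumes S: "open S" "convex S" and g: "g holomorphic_on S"
    and strip: "\<And>s. min a b \<le> Re s \<Longrightarrow> Re s \<le> max a b \<Longrightarrow>
      s \<in> S \<and> norm (g s) \<le> B / (1 + (Im s)\<^sup>2)"
  shows "(LINT t|lborel. g (Complex a t)) = (LINT t|lborel. g (Complex b t))"
proof (cases "a \<le> b")
  case True
  then show ?thesis using strip by (intro vertical_line_shift_aux[OF S g]) auto
next
  case False
  then show ?thesis using strip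
    by (intro vertical_line_shift_aux[OF S g, symmetric]) auto
qed

text \<open>The line is pushed to infinity on the side given by the sign \<open>\<sigma>\<close>, where the decay in \<open>Re s\<close>
  makes the integral tend to zero.\<close>
lemma vertical_line_integral_vanishes:
  assumes g: "g holomorphic_on UNIV" and \<sigma>: "\<sigma> = 1 \<or> \<sigma> = - 1"
    and bound: "\<And>s. 0 \<le> \<sigma> * Re s \<Longrightarrow> norm (g s) \<le> B / ((1 + \<bar>Re s\<bar>) * (1 + (Im s)\<^sup>2))"
  shows "(LINT t|lborel. g (Complex 0 t)) = 0"
proof -
  define I where "I = (LINT t|lborel. 1 / (1 + t\<^sup>2 :: real))"
  have "0 \<le> B / ((1 + \<bar>Re 0\<bar>) * (1 + (Im 0)\<^sup>2))"
    by (rule order_trans[OF norm_ge_zero bound]) simp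
  then have B: "B \<ge> 0" by simp
  have far: "norm (LINT t|lborel. g (Complex 0 t)) \<le> B * I * (1 / (1 + real n))" for n :: nat
  proof -
    have "(LINT t|lborel. g (Complex 0 t)) = (LINT t|lborel. g (Complex (\<sigma> * real n) t))"
    proof (rule vertical_line_shift[OF open_UNIV convex_UNIV g])
      fix s assume "min 0 (\<sigma> * real n) \<le> Re s" "Re s \<le> max 0 (\<sigma> * real n)"
      then have "0 \<le> \<sigma> * Re s" using \<sigma> by auto
      then have "norm (g s) \<le> B / ((1 + \<bar>Re s\<bar>) * (1 + (Im s)\<^sup>2))" by (rule bound)
      also have "\<dots> \<le> B / (1 + (Im s)\<^sup>2)"
      proof (intro divide_left_mono)
        have pos: "1 + (Im s)\<^sup>2 > 0" by (auto intro: add_pos_nonneg)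
        then show "1 + (Im s)\<^sup>2 \<le> (1 + \<bar>Re s\<bar>) * (1 + (Im s)\<^sup>2)"
          by (simp add: distrib_right)
        show "0 < (1 + \<bar>Re s\<bar>) * (1 + (Im s)\<^sup>2) * (1 + (Im s)\<^sup>2)"
          using pos by (intro mult_pos_pos) auto
      qed (rule B)
      finally show "s \<in> UNIV \<and> norm (g s) \<le> B / (1 + (Im s)\<^sup>2)" by simp
    qed
    also have "norm \<dots> \<le> (LINT t|lborel. B / (1 + real n) * (1 / (1 + t\<^sup>2)))"
    proof (rule Bochner_Integration.integral_norm_bound_integral)
      have *: "norm (g (Complex (\<sigma> * real n) t)) \<le> B / (1 + real n) * (1 / (1 + t\<^sup>2))" for t
        using bound[of "Complex (\<sigma> * real n) t"] \<sigma> by auto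
      then show "\<And>t. norm (g (Complex (\<sigma> * real n) t)) \<le> B / (1 + real n) * (1 / (1 + t\<^sup>2))" .
      show "integrable lborel (\<lambda>t. g (Complex (\<sigma> * real n) t))"
        using * by (intro integrable_dominated_by_inverse_square[where B = "B / (1 + real n)"]
            continuous_on_vertical_line[OF g]) auto
    qed (intro integrable_mult_right integrable_inverse_one_plus_square)
    also have "\<dots> = B * I * (1 / (1 + real n))"
      unfolding I_def by (subst integral_mult_right_zero) simp
    finally show ?thesis .
  qed
  have "(\<lambda>n. 1 / (1 + real n)) \<longlonglongrightarrow> 0"
    by real_asymp
  from tendsto_mult_right_zero[OF this, of "B * I"]
  have "(\<lambda>n. B * I * (1 / (1 + real n))) \<longlonglongrightarrow> 0" .
  from LIMSEQ_le_const[OF this, of "norm (LINT t|lborel. g (Complex 0 t))"] far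
  show ?thesis by auto
qed

section \<open>The test kernel and its Fourier support\<close>

text \<open>The halved arguments give the product exponential type one. The exponent \<open>p\<close> fixes the
  decay that enters the final constant, while \<open>q\<close> can be enlarged at no cost.\<close>
definition test_kernel :: "nat \<Rightarrow> nat \<Rightarrow> complex \<Rightarrow> complex" where
  "test_kernel p q z = sinc_kernel p (z / 2) * sinc_kernel q (z / 2)"

lemma test_kernel_holomorphic:
  assumes "p > 0" "q > 0" "g holomorphic_on S"
  shows "(\<lambda>z. test_kernel p q (g z)) holomorphic_on S"
  unfolding test_kernel_def using assms
  by (intro holomorphic_intros sinc_kernel_holomorphic) auto

lemma norm_sinc_kernel_half_decay:
  assumes "m > 0"
  shows "norm (sinc_kernel m (z / 2)) \<le> (8 * real m) ^ (2 * m) * exp (\<bar>Re z\<bar> / 2) / (1 + norm z) ^ (2 * m)"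
proof -
  have "norm (sinc_kernel m (z / 2)) \<le>
      (4 * real m) ^ (2 * m) * exp (\<bar>Re z\<bar> / 2) / (1 + norm z / 2) ^ (2 * m)"
    using norm_sinc_kernel_decay[OF assms, of "z / 2"] by (simp add: norm_divide)
  also have "\<dots> = (8 * real m) ^ (2 * m) * exp (\<bar>Re z\<bar> / 2) / (2 + norm z) ^ (2 * m)"
  proof -
    have e: "1 + norm z / 2 = (2 + norm z) / 2" by simp
    have "(8 * real m) ^ (2 * m) = (2 * (4 * real m)) ^ (2 * m)" by simp
    also have "\<dots> = 2 ^ (2 * m) * (4 * real m) ^ (2 * m)" by (rule power_mult_distrib)
    finally have p: "(8 * real m) ^ (2 * m) = 2 ^ (2 * m) * (4 * real m) ^ (2 * m)" .
    show ?thesis unfolding e power_divide p divide_divide_eq_right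
      by (rule arg_cong2[where f = "(/)"]) (simp_all only: mult_ac)
  qed
  also have "\<dots> \<le> (8 * real m) ^ (2 * m) * exp (\<bar>Re z\<bar> / 2) / (1 + norm z) ^ (2 * m)"
    by (intro divide_left_mono power_mono mult_pos_pos zero_less_power mult_nonneg_nonneg)
       (auto intro: add_pos_nonneg)
  finally show ?thesis .
qed

text \<open>Uniform in \<open>q\<close>: the second factor is merely bounded by its exponential growth.\<close>
lemma norm_test_kernel_le:
  assumes "p > 0" "q > 0"
  shows "norm (test_kernel p q z) \<le> (8 * real p) ^ (2 * p) * exp \<bar>Re z\<bar> / (1 + norm z) ^ (2 * p)"
proof -
  have "norm (test_kernel p q z) \<le>
      ((8 * real p) ^ (2 * p) * exp (\<bar>Re z\<bar> / 2) / (1 + norm z) ^ (2 * p)) * exp (\<bar>Re z\<bar> / 2)"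
    unfolding test_kernel_def norm_mult
    using norm_sinc_kernel_half_decay[OF assms(1), of z] norm_sinc_kernel_le[OF assms(2), of "z / 2"]
    by (intro mult_mono) auto
  also have "\<dots> = (8 * real p) ^ (2 * p) * exp \<bar>Re z\<bar> / (1 + norm z) ^ (2 * p)"
    by (simp add: exp_add[symmetric])
  finally show ?thesis .
qed

lemma norm_test_kernel_decay:
  assumes "p > 0" "q > 0"
  shows "norm (test_kernel p q z) \<le>
    (8 * real p) ^ (2 * p) * (8 * real q) ^ (2 * q) * exp \<bar>Re z\<bar> / (1 + norm z) ^ (2 * p + 2 * q)"
proof -
  have "norm (test_kernel p q z) \<le>
      ((8 * real p) ^ (2 * p) * exp (\<bar>Re z\<bar> / 2) / (1 + norm z) ^ (2 * p)) *
      ((8 * real q) ^ (2 * q) * exp (\<bar>Re z\<bar> / 2) / (1 + norm z) ^ (2 * q))"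
    unfolding test_kernel_def norm_mult
    using norm_sinc_kernel_half_decay[OF assms(1), of z] norm_sinc_kernel_half_decay[OF assms(2), of z]
    by (intro mult_mono) auto
  also have "\<dots> = (8 * real p) ^ (2 * p) * (8 * real q) ^ (2 * q) * exp \<bar>Re z\<bar> / (1 + norm z) ^ (2 * p + 2 * q)"
    by (simp add: exp_add[symmetric] power_add)
  finally show ?thesis .
qed

definition kernel_mass :: "nat \<Rightarrow> nat \<Rightarrow> real \<Rightarrow> complex" where
  "kernel_mass p q \<epsilon> = (LINT t|lborel. test_kernel p q (of_real \<epsilon> * Complex 0 t))"

lemma one_plus_scaled_square_ge:
  fixes \<epsilon> t :: real
  assumes "0 < \<epsilon>" "\<epsilon> \<le> 1"
  shows "\<epsilon>\<^sup>2 * (1 + t\<^sup>2) \<le> (1 + \<epsilon> * \<bar>t\<bar>)\<^sup>2"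
proof -
  have "\<epsilon>\<^sup>2 \<le> 1" using assms by (simp add: power_le_one)
  moreover have "0 \<le> \<epsilon> * \<bar>t\<bar>" using assms by simp
  ultimately show ?thesis by (simp add: power2_eq_square algebra_simps)
qed

lemma one_plus_scaled_norm_ge:
  assumes "0 < \<epsilon>" "\<epsilon> \<le> 1"
  shows "\<epsilon>\<^sup>2 * (1 + (Im s)\<^sup>2) \<le> (1 + \<epsilon> * norm s)\<^sup>2"
proof -
  have "(1 + \<epsilon> * \<bar>Im s\<bar>)\<^sup>2 \<le> (1 + \<epsilon> * norm s)\<^sup>2"
    using assms abs_Im_le_cmod[of s] by (intro power_mono add_left_mono mult_left_mono) auto
  then show ?thesis
    using one_plus_scaled_square_ge[OF assms, of "Im s"] by linarith
qed

lemma integral_exp_test_kernel_shift: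
  assumes pq: "p > 0" "q > 0" and \<epsilon>: "0 < \<epsilon>" "\<epsilon> \<le> 1"
  shows "(LINT t|lborel. exp (of_real y * Complex c t) * test_kernel p q (of_real \<epsilon> * Complex c t))
    = (LINT t|lborel. exp (of_real y * Complex 0 t) * test_kernel p q (of_real \<epsilon> * Complex 0 t))"
proof (rule vertical_line_shift[OF open_UNIV convex_UNIV])
  show "(\<lambda>s. exp (of_real y * s) * test_kernel p q (of_real \<epsilon> * s)) holomorphic_on UNIV"
    using pq by (intro holomorphic_intros test_kernel_holomorphic)
next
  fix s assume s: "min c 0 \<le> Re s" "Re s \<le> max c 0"
  define K where "K = (8 * real p) ^ (2 * p)"
  have K: "K \<ge> 0" by (simp add: K_def)
  have Re: "\<bar>Re s\<bar> \<le> \<bar>c\<bar>" using s by auto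
  have "y * Re s \<le> \<bar>y\<bar> * \<bar>Re s\<bar>"
    using abs_ge_self[of "y * Re s"] by (simp only: abs_mult)
  also have "\<dots> \<le> \<bar>y\<bar> * \<bar>c\<bar>" by (rule mult_left_mono[OF Re]) simp
  finally have "y * Re s \<le> \<bar>y\<bar> * \<bar>c\<bar>" .
  moreover have "\<bar>\<epsilon> * Re s\<bar> \<le> 1 * \<bar>c\<bar>"
    unfolding abs_mult by (rule mult_mono) (use Re \<epsilon> in auto)
  ultimately have e: "exp (y * Re s) * exp \<bar>\<epsilon> * Re s\<bar> \<le> exp (\<bar>y\<bar> * \<bar>c\<bar> + \<bar>c\<bar>)"
    unfolding exp_add[symmetric] exp_le_cancel_iff by linarith
  have "norm (test_kernel p q (of_real \<epsilon> * s)) \<le> K * exp \<bar>\<epsilon> * Re s\<bar> / (1 + \<epsilon> * norm s) ^ (2 * p)"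
    using norm_test_kernel_le[OF pq, of "of_real \<epsilon> * s"] \<epsilon> by (simp add: norm_mult K_def)
  also have "\<dots> \<le> K * exp \<bar>\<epsilon> * Re s\<bar> / (\<epsilon>\<^sup>2 * (1 + (Im s)\<^sup>2))"
  proof (intro divide_left_mono)
    have "(1 + \<epsilon> * norm s)\<^sup>2 \<le> (1 + \<epsilon> * norm s) ^ (2 * p)"
      using \<epsilon> pq by (intro power_increasing) auto
    then show "\<epsilon>\<^sup>2 * (1 + (Im s)\<^sup>2) \<le> (1 + \<epsilon> * norm s) ^ (2 * p)"
      using one_plus_scaled_norm_ge[OF \<epsilon>, of s] by linarith
    have "1 + (Im s)\<^sup>2 > 0" "1 + \<epsilon> * norm s > 0"
      using \<epsilon> by (auto intro: add_pos_nonneg)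
    then show "0 < (1 + \<epsilon> * cmod s) ^ (2 * p) * (\<epsilon>\<^sup>2 * (1 + (Im s)\<^sup>2))"
      using \<epsilon> by simp
  qed (use K in simp)
  finally have t: "norm (test_kernel p q (of_real \<epsilon> * s)) \<le> K * exp \<bar>\<epsilon> * Re s\<bar> / (\<epsilon>\<^sup>2 * (1 + (Im s)\<^sup>2))" .
  have "norm (exp (of_real y * s) * test_kernel p q (of_real \<epsilon> * s))
     \<le> exp (y * Re s) * (K * exp \<bar>\<epsilon> * Re s\<bar> / (\<epsilon>\<^sup>2 * (1 + (Im s)\<^sup>2)))"
    unfolding norm_mult using t by (intro mult_mono) (auto simp: norm_exp_eq_Re)
  also have "\<dots> = K * (exp (y * Re s) * exp \<bar>\<epsilon> * Re s\<bar>) / \<epsilon>\<^sup>2 / (1 + (Im s)\<^sup>2)"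
    by simp
  also have "\<dots> \<le> K * exp (\<bar>y\<bar> * \<bar>c\<bar> + \<bar>c\<bar>) / \<epsilon>\<^sup>2 / (1 + (Im s)\<^sup>2)"
    using e K by (intro divide_right_mono mult_left_mono) auto
  finally show "s \<in> UNIV \<and> norm (exp (of_real y * s) * test_kernel p q (of_real \<epsilon> * s))
      \<le> K * exp (\<bar>y\<bar> * \<bar>c\<bar> + \<bar>c\<bar>) / \<epsilon>\<^sup>2 / (1 + (Im s)\<^sup>2)" by simp
qed

text \<open>The Paley-Wiener property of the kernel. When \<open>\<bar>y\<bar> \<ge> \<epsilon>\<close>, the factor \<open>exp (y s)\<close> compensates the
  growth of the kernel in one of the two half planes, so the line can be pushed to infinity there.\<close>
lemma integral_exp_test_kernel_vanishes:
  assumes pq: "p > 0" "q > 0" and \<epsilon>: "0 < \<epsilon>" "\<epsilon> \<le> 1" and y: "\<epsilon> \<le> \<bar>y\<bar>"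
  shows "(LINT t|lborel. exp (of_real y * Complex c t) * test_kernel p q (of_real \<epsilon> * Complex c t)) = 0"
proof -
  define K where "K = (8 * real p) ^ (2 * p) * (8 * real q) ^ (2 * q)"
  have K: "K \<ge> 0" by (simp add: K_def)
  have "(LINT t|lborel. exp (of_real y * Complex 0 t) * test_kernel p q (of_real \<epsilon> * Complex 0 t)) = 0"
  proof (rule vertical_line_integral_vanishes[where \<sigma> = "- sgn y" and B = "K / \<epsilon> ^ 3"])
    show "(\<lambda>s. exp (of_real y * s) * test_kernel p q (of_real \<epsilon> * s)) holomorphic_on UNIV"
      using pq by (intro holomorphic_intros test_kernel_holomorphic)
    \<comment> \<open>\<open>exp (y s)\<close> decays to the left if \<open>y > 0\<close> and to the right if \<open>y < 0\<close>\<close>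
    show "- sgn y = 1 \<or> - sgn y = - 1"
      using y \<epsilon> by (auto simp: sgn_if)
  next
    fix s assume "0 \<le> - sgn y * Re s"
    then have "y * Re s = - (\<bar>y\<bar> * \<bar>Re s\<bar>)"
      using y \<epsilon> by (cases "y > 0") (auto simp: abs_if)
    also have "\<dots> \<le> - \<bar>\<epsilon> * Re s\<bar>"
      using mult_right_mono[OF y, of "\<bar>Re s\<bar>"] \<epsilon> by (simp add: abs_mult)
    finally have e: "exp (y * Re s) * exp \<bar>\<epsilon> * Re s\<bar> \<le> 1"
      unfolding exp_add[symmetric] exp_le_one_iff by linarith
    define X where "X = 1 + \<epsilon> * norm s"
    have X1: "X \<ge> 1" using \<epsilon> by (simp add: X_def)
    have "\<epsilon> * \<bar>Re s\<bar> \<le> \<epsilon> * norm s"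
      using \<epsilon> abs_Re_le_cmod[of s] by (intro mult_left_mono) auto
    then have a: "\<epsilon> * (1 + \<bar>Re s\<bar>) \<le> X"
      unfolding X_def distrib_left using \<epsilon> by linarith
    have "\<epsilon> * (1 + \<bar>Re s\<bar>) * (\<epsilon>\<^sup>2 * (1 + (Im s)\<^sup>2)) \<le> X * X\<^sup>2"
      using a one_plus_scaled_norm_ge[OF \<epsilon>, of s] \<epsilon> X1
      by (intro mult_mono) (auto simp: X_def)
    also have "\<dots> = X ^ 3" by (simp add: power2_eq_square power3_eq_cube)
    also have "\<dots> \<le> X ^ (2 * p + 2 * q)"
      using X1 pq by (intro power_increasing) auto
    finally have X: "\<epsilon> ^ 3 * ((1 + \<bar>Re s\<bar>) * (1 + (Im s)\<^sup>2)) \<le> X ^ (2 * p + 2 * q)"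
      by (simp add: power2_eq_square power3_eq_cube mult_ac)
    have pos: "\<epsilon> ^ 3 * ((1 + \<bar>Re s\<bar>) * (1 + (Im s)\<^sup>2)) > 0"
      using \<epsilon> by (intro mult_pos_pos) (auto intro: add_pos_nonneg)
    have "norm (test_kernel p q (of_real \<epsilon> * s)) \<le> K * exp \<bar>\<epsilon> * Re s\<bar> / X ^ (2 * p + 2 * q)"
      using norm_test_kernel_decay[OF pq, of "of_real \<epsilon> * s"] \<epsilon> by (simp add: norm_mult K_def X_def)
    also have "\<dots> \<le> K * exp \<bar>\<epsilon> * Re s\<bar> / (\<epsilon> ^ 3 * ((1 + \<bar>Re s\<bar>) * (1 + (Im s)\<^sup>2)))"
      using X K X1 pos by (intro divide_left_mono mult_pos_pos[OF _ pos]) auto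
    finally have t: "norm (test_kernel p q (of_real \<epsilon> * s)) \<le> \<dots>" .
    have "norm (exp (of_real y * s) * test_kernel p q (of_real \<epsilon> * s))
      \<le> exp (y * Re s) * (K * exp \<bar>\<epsilon> * Re s\<bar> / (\<epsilon> ^ 3 * ((1 + \<bar>Re s\<bar>) * (1 + (Im s)\<^sup>2))))"
      unfolding norm_mult using t by (intro mult_mono) (auto simp: norm_exp_eq_Re)
    also have "\<dots> = K * (exp (y * Re s) * exp \<bar>\<epsilon> * Re s\<bar>) / (\<epsilon> ^ 3 * ((1 + \<bar>Re s\<bar>) * (1 + (Im s)\<^sup>2)))"
      by simp
    also have "\<dots> \<le> K * 1 / (\<epsilon> ^ 3 * ((1 + \<bar>Re s\<bar>) * (1 + (Im s)\<^sup>2)))"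
      using e K pos by (intro divide_right_mono mult_left_mono) auto
    finally show "norm (exp (of_real y * s) * test_kernel p q (of_real \<epsilon> * s))
      \<le> K / \<epsilon> ^ 3 / ((1 + \<bar>Re s\<bar>) * (1 + (Im s)\<^sup>2))" by simp
  qed
  then show ?thesis
    using integral_exp_test_kernel_shift[OF pq \<epsilon>, of y c] by simp
qed

lemma integral_test_kernel_line:
  assumes pq: "p > 0" "q > 0" and \<epsilon>: "0 < \<epsilon>" "\<epsilon> \<le> 1"
  shows "(LINT t|lborel. test_kernel p q (of_real \<epsilon> * Complex c t)) = kernel_mass p q \<epsilon>"
  using integral_exp_test_kernel_shift[OF pq \<epsilon>, of 0 c] by (simp add: kernel_mass_def)

text \<open>On the imaginary axis the kernel is nonnegative, and for \<open>\<bar>t\<bar> \<le> 2 / \<epsilon>\<close> each of its factors is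
  at least \<open>1/2\<close>; the interval has length \<open>4 / \<epsilon>\<close>.\<close>
lemma norm_kernel_mass_ge:
  assumes pq: "p > 0" "q > 0" and \<epsilon>: "0 < \<epsilon>" "\<epsilon> \<le> 1"
  shows "1 / \<epsilon> \<le> norm (kernel_mass p q \<epsilon>)"
proof -
  define T where "T t = test_kernel p q (of_real \<epsilon> * Complex 0 t)" for t
  have arg: "of_real \<epsilon> * Complex 0 t / 2 = \<i> * of_real (\<epsilon> * t / 2)" for t
    by (simp add: complex_eq_iff)
  have T_nonneg: "0 \<le> Re (T t)" for t
  proof -
    obtain r1 r2 where "sinc_kernel p (\<i> * of_real (\<epsilon> * t / 2)) = of_real r1" "0 \<le> r1"
      "sinc_kernel q (\<i> * of_real (\<epsilon> * t / 2)) = of_real r2" "0 \<le> r2"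
      using sinc_kernel_imaginary by metis
    then show ?thesis unfolding T_def test_kernel_def arg by simp
  qed
  have T_ge: "1 / 4 \<le> Re (T t)" if "\<bar>t\<bar> \<le> 2 / \<epsilon>" for t
  proof -
    have "\<bar>\<epsilon> * t / 2\<bar> \<le> 1"
      using that \<epsilon> by (simp add: abs_mult field_simps)
    then have h: "1 / 2 \<le> Re (sinc_kernel p (\<i> * of_real (\<epsilon> * t / 2)))"
      "1 / 2 \<le> Re (sinc_kernel q (\<i> * of_real (\<epsilon> * t / 2)))"
      using Re_sinc_kernel_ge pq by blast+
    obtain r1 r2 where r: "sinc_kernel p (\<i> * of_real (\<epsilon> * t / 2)) = of_real r1"
      "sinc_kernel q (\<i> * of_real (\<epsilon> * t / 2)) = of_real r2"
      using sinc_kernel_imaginary by metis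
    have "1 / 2 * (1 / 2) \<le> r1 * r2" using h r by (intro mult_mono) auto
    then show ?thesis unfolding T_def test_kernel_def arg r by simp
  qed
  have "norm (T t) \<le> ((8 * real p) ^ (2 * p) / \<epsilon>\<^sup>2) / (1 + t\<^sup>2)" for t
  proof -
    have "norm (T t) \<le> (8 * real p) ^ (2 * p) / (1 + \<epsilon> * \<bar>t\<bar>) ^ (2 * p)"
    proof -
      have "norm (Complex 0 t) = \<bar>t\<bar>" by (simp add: cmod_def)
      then have "norm (of_real \<epsilon> * Complex 0 t) = \<epsilon> * \<bar>t\<bar>" "Re (of_real \<epsilon> * Complex 0 t) = 0"
        using \<epsilon> by (simp_all add: norm_mult)
      then show ?thesis
        using norm_test_kernel_le[OF pq, of "of_real \<epsilon> * Complex 0 t"] by (simp add: T_def)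
    qed
    also have "\<dots> \<le> (8 * real p) ^ (2 * p) / (\<epsilon>\<^sup>2 * (1 + t\<^sup>2))"
    proof (intro divide_left_mono)
      have "(1 + \<epsilon> * \<bar>t\<bar>)\<^sup>2 \<le> (1 + \<epsilon> * \<bar>t\<bar>) ^ (2 * p)"
        using \<epsilon> pq by (intro power_increasing) auto
      then show "\<epsilon>\<^sup>2 * (1 + t\<^sup>2) \<le> (1 + \<epsilon> * \<bar>t\<bar>) ^ (2 * p)"
        using one_plus_scaled_square_ge[OF \<epsilon>, of t] by linarith
      have "1 + t\<^sup>2 > 0" "1 + \<epsilon> * \<bar>t\<bar> > 0"
        using \<epsilon> by (auto intro: add_pos_nonneg)
      then show "0 < (1 + \<epsilon> * \<bar>t\<bar>) ^ (2 * p) * (\<epsilon>\<^sup>2 * (1 + t\<^sup>2))"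
        using \<epsilon> by simp
    qed simp
    finally show ?thesis by simp
  qed
  then have int: "integrable lborel T"
    unfolding T_def using pq
    by (intro integrable_dominated_by_inverse_square[where B = "(8 * real p) ^ (2 * p) / \<epsilon>\<^sup>2"]
        continuous_on_vertical_line[where S = UNIV] test_kernel_holomorphic holomorphic_intros) auto
  define J where "J = {- (2 / \<epsilon>)..2 / \<epsilon>}"
  have J: "measure lborel J = 4 / \<epsilon>"
    using \<epsilon> by (simp add: J_def)
  have J_fin: "emeasure lborel J < \<infinity>"
    unfolding J_def emeasure_lborel_Icc_eq by simp
  have "1 / \<epsilon> = (LINT t|lborel. indicator J t *\<^sub>R (1 / 4))"
    using J J_fin by (simp add: J_def)
  also have "\<dots> \<le> (LINT t|lborel. Re (T t))"
  proof (rule integral_mono)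
    show "integrable lborel (\<lambda>t. indicator J t *\<^sub>R (1 / 4 :: real))"
      using J_fin by (simp add: J_def)
    show "integrable lborel (\<lambda>t. Re (T t))" using int by (rule integrable_Re)
    fix t
    show "indicator J t *\<^sub>R (1 / 4) \<le> Re (T t)"
    proof (cases "t \<in> J")
      case True
      then have "\<bar>t\<bar> \<le> 2 / \<epsilon>" unfolding J_def by (simp add: abs_le_iff)
      from T_ge[OF this] True show ?thesis by simp
    next
      case False
      then show ?thesis using T_nonneg[of t] by simp
    qed
  qed
  also have "\<dots> = Re (kernel_mass p q \<epsilon>)"
    unfolding kernel_mass_def T_def[symmetric] by (rule integral_Re[OF int])
  also have "\<dots> \<le> norm (kernel_mass p q \<epsilon>)" by (rule complex_Re_le_cmod)
  finally show ?thesis .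
qed

section \<open>Twisting a truncated power by an exponential\<close>

lemma iterated_deriv_power:
  "(deriv ^^ i) (\<lambda>z::complex. z ^ L) =
     (\<lambda>z. if i \<le> L then fact L / fact (L - i) * z ^ (L - i) else 0)"
proof (induction i)
  case 0
  show ?case by simp
next
  case (Suc i)
  show ?case
  proof
    fix z :: complex
    consider "i < L" | "i = L" | "i > L" by linarith
    then show "(deriv ^^ Suc i) (\<lambda>z. z ^ L) z =
        (if Suc i \<le> L then fact L / fact (L - Suc i) * z ^ (L - Suc i) else 0)"
    proof cases
      case 1
      define m where "m = L - Suc i"
      have m: "L - i = Suc m" using 1 by (simp add: m_def)
      have "((\<lambda>z. fact L / fact (L - i) * z ^ (L - i)) has_field_derivative
          fact L / fact (Suc m) * (of_nat (Suc m) * z ^ m)) (at z)"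
        unfolding m by (rule derivative_eq_intros refl)+ (simp del: of_nat_Suc power_Suc fact_Suc)
      then have "deriv (\<lambda>z. fact L / fact (L - i) * z ^ (L - i)) z =
          fact L / fact (Suc m) * (of_nat (Suc m) * z ^ m)"
        by (rule DERIV_imp_deriv)
      also have "\<dots> = fact L / fact m * z ^ m"
      proof -
        have "(of_nat (Suc m) :: complex) \<noteq> 0" by (simp only: of_nat_eq_0_iff)
        then show ?thesis unfolding fact_Suc of_nat_mult by simp
      qed
      finally show ?thesis using 1 by (simp add: Suc.IH m_def)
    next
      case 2
      have "(deriv ^^ i) (\<lambda>z::complex. z ^ L) = (\<lambda>z. fact L)"
        unfolding Suc.IH using 2 by simp
      then show ?thesis using 2 by simp
    qed (simp_all add: Suc.IH)
  qed
qed

lemma iterated_deriv_exp_mult: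
  "(deriv ^^ n) (\<lambda>z::complex. exp (w * z)) = (\<lambda>z. w ^ n * exp (w * z))"
proof (induction n)
  case 0
  show ?case by simp
next
  case (Suc n)
  show ?case
  proof
    fix z
    have "((\<lambda>z. w ^ n * exp (w * z)) has_field_derivative w ^ Suc n * exp (w * z)) (at z)"
      by (auto intro!: derivative_eq_intros)
    then show "(deriv ^^ Suc n) (\<lambda>z::complex. exp (w * z)) z = w ^ Suc n * exp (w * z)"
      by (simp add: Suc.IH DERIV_imp_deriv)
  qed
qed

lemma iterated_deriv_power_exp:
  "(deriv ^^ n) (\<lambda>z::complex. z ^ L * exp (w * z)) z =
     (\<Sum>i=0..n. of_nat (n choose i) * (if i \<le> L then fact L / fact (L - i) * z ^ (L - i) else 0)
        * (w ^ (n - i) * exp (w * z)))"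
proof -
  have "(deriv ^^ n) (\<lambda>z::complex. z ^ L * exp (w * z)) z =
      (\<Sum>i=0..n. of_nat (n choose i) * (deriv ^^ i) (\<lambda>z. z ^ L) z * (deriv ^^ (n - i)) (\<lambda>z. exp (w * z)) z)"
    by (rule higher_deriv_mult[where S = UNIV]) (auto intro!: holomorphic_intros)
  then show ?thesis
    unfolding iterated_deriv_power iterated_deriv_exp_mult .
qed

text \<open>The function \<open>y \<mapsto> y\<^sup>L exp (w y)\<close> is \<open>y\<^sup>L\<close> plus the convolution of \<open>y\<^sup>L\<close> with a kernel
  \<open>k\<close>. This is Taylor's formula at zero with integral remainder: the derivatives of order less than \<open>L\<close>
  vanish there, the derivative of order \<open>L\<close> produces \<open>y\<^sup>L\<close>, and the next one, divided by the
  factorial of \<open>L\<close>, is \<open>k\<close>.\<close>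
lemma twisted_power_convolution:
  obtains k :: "real \<Rightarrow> complex" where
    "\<And>z. z \<ge> 0 \<Longrightarrow> norm (k z) \<le>
       exp (Re w * z) * (\<Sum>m\<le>L. of_nat (Suc L choose Suc m) * norm w ^ Suc m * (z ^ m / fact m))"
    "\<And>y. y \<ge> 0 \<Longrightarrow>
       ((\<lambda>z. (y - z) ^ L *\<^sub>R k z) has_integral (of_real y ^ L * exp (w * of_real y) - of_real y ^ L)) {0..y}"
proof -
  define G where "G z = z ^ L * exp (w * z)" for z :: complex
  define k where "k t = (1 / fact L) *\<^sub>R (deriv ^^ Suc L) G (of_real t)" for t :: real
  have G: "G holomorphic_on UNIV"
    unfolding G_def by (intro holomorphic_intros)
  have dG: "(deriv ^^ n) G z = (\<Sum>i=0..n. of_nat (n choose i) *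
      (if i \<le> L then fact L / fact (L - i) * z ^ (L - i) else 0) * (w ^ (n - i) * exp (w * z)))" for n z
    unfolding G_def[abs_def] by (rule iterated_deriv_power_exp)
  show thesis
  proof (rule that[of k])
    fix z :: real assume z: "z \<ge> 0"
    have "(deriv ^^ Suc L) G (of_real z) = (\<Sum>i=0..L. of_nat (Suc L choose i) *
      (fact L / fact (L - i) * of_real z ^ (L - i)) * (w ^ (Suc L - i) * exp (w * of_real z)))"
      unfolding dG by (subst sum.atLeast0_atMost_Suc) simp
    also have "\<dots> = (\<Sum>m=0..L. of_nat (Suc L choose Suc m) *
      (fact L / fact m * of_real z ^ m) * (w ^ Suc m * exp (w * of_real z)))"
    proof (rule sum.reindex_bij_witness[where i = "\<lambda>m. L - m" and j = "\<lambda>m. L - m"])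
      fix i assume i: "i \<in> {0..L}"
      have "Suc L choose Suc (L - i) = Suc L choose i"
        using i binomial_symmetric[of i "Suc L"] by (simp add: Suc_diff_le)
      moreover have "Suc L - i = Suc (L - i)" using i by (simp add: Suc_diff_le)
      ultimately show "of_nat (Suc L choose Suc (L - i)) * (fact L / fact (L - i) * of_real z ^ (L - i)) *
          (w ^ Suc (L - i) * exp (w * of_real z)) =
          of_nat (Suc L choose i) * (fact L / fact (L - i) * of_real z ^ (L - i)) * (w ^ (Suc L - i) * exp (w * of_real z))"
        by simp
    qed auto
    finally have "norm ((deriv ^^ Suc L) G (of_real z)) \<le> (\<Sum>m=0..L. norm (of_nat (Suc L choose Suc m) *
      (fact L / fact m * of_real z ^ m) * (w ^ Suc m * exp (w * of_real z))))"
      by (simp only: norm_sum)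
    also have "\<dots> = (\<Sum>m=0..L. fact L * exp (Re w * z) *
        (of_nat (Suc L choose Suc m) * norm w ^ Suc m * (z ^ m / fact m)))"
      using z by (intro sum.cong refl)
        (simp only: norm_mult norm_divide norm_power norm_fact norm_of_nat norm_of_real norm_exp_eq_Re abs_of_nonneg times_complex.sel Re_complex_of_real Im_complex_of_real mult_zero_right mult_zero_left diff_zero times_divide_eq_left times_divide_eq_right mult_ac)
    finally have "norm ((deriv ^^ Suc L) G (of_real z)) \<le>
       fact L * (exp (Re w * z) * (\<Sum>m=0..L. of_nat (Suc L choose Suc m) * norm w ^ Suc m * (z ^ m / fact m)))"
      by (simp only: sum_distrib_left mult.assoc)
    then have "norm (k z) \<le> exp (Re w * z) * (\<Sum>m=0..L. of_nat (Suc L choose Suc m) * norm w ^ Suc m * (z ^ m / fact m))"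
      unfolding k_def norm_scaleR by (simp only: abs_of_nonneg zero_le_divide_1_iff fact_ge_zero) (simp only: mult.commute[of "1 / fact L"] times_divide_eq_right mult_1_right pos_divide_le_eq fact_gt_zero mult.commute[of _ "fact L"])
    then show "norm (k z) \<le> exp (Re w * z) * (\<Sum>m\<le>L. of_nat (Suc L choose Suc m) * norm w ^ Suc m * (z ^ m / fact m))"
      by (simp only: atLeast0AtMost)
  next
    fix y :: real assume y: "y \<ge> 0"
    \<comment> \<open>the expansion ends with order \<open>L\<close>, so the remainder carries the derivative of order \<open>Suc L\<close>\<close>
    have "((\<lambda>x. ((y - x) ^ (Suc L - 1) / fact (Suc L - 1)) *\<^sub>R (deriv ^^ Suc L) G (of_real x)) has_integral
        G (of_real y) - (\<Sum>i<Suc L. ((y - 0) ^ i / fact i) *\<^sub>R (deriv ^^ i) G (of_real 0))) {0..y}"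
    proof (rule Taylor_has_integral[where Df = "\<lambda>n x. (deriv ^^ n) G (of_real x)" and f = "\<lambda>x. G (of_real x)"])
      fix m t
      have "((deriv ^^ m) G has_field_derivative (deriv ^^ Suc m) G (of_real t)) (at (of_real t))"
        by (rule has_field_derivative_higher_deriv[OF G open_UNIV]) simp
      then show "((\<lambda>x. (deriv ^^ m) G (of_real x)) has_vector_derivative (deriv ^^ Suc m) G (of_real t)) (at t within {0..y})"
        by (rule has_vector_derivative_real_field)
    qed (use y in auto)
    moreover have "(\<Sum>i<Suc L. ((y - 0) ^ i / fact i) *\<^sub>R (deriv ^^ i) G (of_real 0)) = of_real y ^ L"
    proof -
      have z: "(deriv ^^ i) G 0 = 0" if "i < L" for i
        unfolding dG using that by (intro sum.neutral) auto
      have "(deriv ^^ L) G 0 = (\<Sum>i=0..L. if i = L then fact L else 0)"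
        unfolding dG by (intro sum.cong refl) auto
      then have "(deriv ^^ L) G 0 = fact L" by simp
      then show ?thesis
        by (simp add: z scaleR_conv_of_real)
    qed
    moreover have "((y - x) ^ (Suc L - 1) / fact (Suc L - 1)) *\<^sub>R (deriv ^^ Suc L) G (of_real x)
        = (y - x) ^ L *\<^sub>R k x" for x
      unfolding k_def by simp
    ultimately show "((\<lambda>z. (y - z) ^ L *\<^sub>R k z) has_integral (of_real y ^ L * exp (w * of_real y) - of_real y ^ L)) {0..y}"
      unfolding G_def by simp
  qed
qed

lemma power_over_fact_le:
  fixes z :: real
  assumes "z \<ge> 0"
  shows "z ^ m / fact m \<le> 2 ^ m * exp (z / 2)"
proof -
  have "(\<Sum>i\<in>{m}. (z / 2) ^ i /\<^sub>R fact i) \<le> (\<Sum>i. (z / 2) ^ i /\<^sub>R fact i)"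
    by (rule sum_le_suminf[OF summable_exp_generic]) (use assms in simp_all)
  also have "\<dots> = exp (z / 2)" by (simp only: exp_def)
  finally have "(z / 2) ^ m / fact m \<le> exp (z / 2)"
    by (simp only: sum.insert finite.emptyI empty_iff not_False_eq_True sum.empty add_0_right
        real_scaleR_def divide_inverse[of _ "fact m"] mult.commute)
  from mult_left_mono[OF this, of "2 ^ m"] show ?thesis
    by (simp add: power_divide)
qed

lemma binomial_tail_le:
  fixes c :: real
  assumes "c \<ge> 0"
  shows "(\<Sum>m\<le>L. of_nat (Suc L choose Suc m) * c ^ Suc m * 2 ^ m) \<le> (1 + 2 * c) ^ Suc L"
proof -
  have "(\<Sum>m\<le>L. of_nat (Suc L choose Suc m) * c ^ Suc m * 2 ^ m)
      \<le> (\<Sum>m\<le>L. of_nat (Suc L choose Suc m) * (2 * c) ^ Suc m)"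
  proof (rule sum_mono)
    fix m
    have "c ^ Suc m * 2 ^ m \<le> c ^ Suc m * 2 ^ Suc m"
      using assms by (intro mult_left_mono power_increasing) auto
    also have "\<dots> = (c * 2) ^ Suc m" by (rule power_mult_distrib[symmetric])
    also have "\<dots> = (2 * c) ^ Suc m" by (simp only: mult.commute)
    finally show "of_nat (Suc L choose Suc m) * c ^ Suc m * 2 ^ m \<le> of_nat (Suc L choose Suc m) * (2 * c) ^ Suc m"
      unfolding mult.assoc by (rule mult_left_mono) simp
  qed
  also have "\<dots> \<le> (\<Sum>j\<le>Suc L. of_nat (Suc L choose j) * (2 * c) ^ j * 1 ^ (Suc L - j))"
    by (subst sum.atMost_Suc_shift) (simp del: binomial_Suc_Suc power_Suc of_nat_Suc)
  also have "\<dots> = (2 * c + 1) ^ Suc L" by (rule binomial_ring[symmetric])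
  also have "2 * c + 1 = 1 + 2 * c" by simp
  finally show ?thesis .
qed

text \<open>Let \<open>A v\<close> be the sum of the \<open>b n (v - lam n)\<^sup>L\<close> over \<open>lam n \<le> v\<close>. By \<open>twisted_power_convolution\<close>,
  multiplying the coefficients by \<open>exp (- lam n w)\<close> turns \<open>A x\<close> into
  \<open>exp (- x w)\<close> times \<open>A x + \<integral> A (x - z) k z dz\<close>. So the bound on \<open>A\<close> is inherited, with a loss that is
  polynomial in \<open>w\<close> and does not depend on \<open>x\<close>. The normalisation \<open>Re w = 1\<close> makes the
  convolution integral converge uniformly in \<open>x\<close>.\<close>
lemma twisted_riesz_sum_bound:
  fixes b :: "nat \<Rightarrow> complex" and lam :: "nat \<Rightarrow> real"
  assumes S: "finite S" and L: "L \<ge> 1" and x: "x > 0"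
    and lam: "\<And>n. n \<in> S \<Longrightarrow> 0 \<le> lam n \<and> lam n \<le> x"
    and w: "Re w = 1" and K: "K \<ge> 0"
    and A: "\<And>v. 0 \<le> v \<Longrightarrow> v \<le> x \<Longrightarrow>
       norm (\<Sum>n\<in>S. b n * of_real (max 0 (v - lam n) ^ L)) \<le> K * v ^ L"
  shows "norm (\<Sum>n\<in>S. b n * of_real ((1 - lam n / x) ^ L) * exp (- of_real (lam n) * w))
     \<le> K * (1 + 2 * (1 + 2 * norm w) ^ Suc L)"
proof -
  obtain k :: "real \<Rightarrow> complex" where k_le: "\<And>z. z \<ge> 0 \<Longrightarrow> norm (k z) \<le>
       exp (Re w * z) * (\<Sum>m\<le>L. of_nat (Suc L choose Suc m) * norm w ^ Suc m * (z ^ m / fact m))"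
    and k_conv: "\<And>y. y \<ge> 0 \<Longrightarrow> ((\<lambda>z. (y - z) ^ L *\<^sub>R k z) has_integral
         (of_real y ^ L * exp (w * of_real y) - of_real y ^ L)) {0..y}"
    by (rule twisted_power_convolution[where L = L and w = w]) (rule that)
  define A where "A v = (\<Sum>n\<in>S. b n * of_real (max 0 (v - lam n) ^ L))" for v
  define W where "W = (\<Sum>m\<le>L. of_nat (Suc L choose Suc m) * norm w ^ Suc m * 2 ^ m)"
  have W: "0 \<le> W" "W \<le> (1 + 2 * norm w) ^ Suc L"
    unfolding W_def
    by (intro sum_nonneg mult_nonneg_nonneg zero_le_power norm_ge_zero of_nat_0_le_iff zero_le_numeral,
        rule binomial_tail_le[OF norm_ge_zero])
  have conv: "((\<lambda>z. of_real (max 0 (x - z - lam n) ^ L) * k z) has_integral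
      (of_real (x - lam n) ^ L * exp (w * of_real (x - lam n)) - of_real (x - lam n) ^ L)) {0..x}"
    if "n \<in> S" for n
  proof -
    define y where "y = x - lam n"
    have y: "0 \<le> y" "y \<le> x" using lam[OF that] by (auto simp: y_def)
    have 1: "((\<lambda>z. of_real (max 0 (y - z) ^ L) * k z) has_integral
         (of_real y ^ L * exp (w * of_real y) - of_real y ^ L)) {0..y}"
    proof (rule has_integral_eq[OF _ k_conv[OF y(1)]])
      fix z assume "z \<in> {0..y}"
      then have "max 0 (y - z) = y - z" by simp
      then show "(y - z) ^ L *\<^sub>R k z = of_real (max 0 (y - z) ^ L) * k z"
        by (simp only: scaleR_conv_of_real)
    qed
    have 2: "((\<lambda>z. of_real (max 0 (y - z) ^ L) * k z) has_integral 0) {y..x}"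
    proof (rule has_integral_is_0)
      fix z assume "z \<in> {y..x}"
      then have "max 0 (y - z) = 0" by simp
      moreover have "(0::real) ^ L = 0" using L by (simp add: power_0_left)
      ultimately show "of_real (max 0 (y - z) ^ L) * k z = 0" by (simp only: of_real_0 mult_zero_left)
    qed
    have y_eq: "x - z - lam n = y - z" for z by (simp add: y_def)
    show ?thesis
      using has_integral_combine[OF y 1 2] unfolding y_eq y_def[symmetric] by (simp only: add_0_right)
  qed
  define J where "J = (\<Sum>n\<in>S. b n * (of_real (x - lam n) ^ L * exp (w * of_real (x - lam n)) - of_real (x - lam n) ^ L))"
  have J: "((\<lambda>z. A (x - z) * k z) has_integral J) {0..x}"
  proof -
    have "((\<lambda>z. \<Sum>n\<in>S. b n * (of_real (max 0 (x - z - lam n) ^ L) * k z)) has_integral J) {0..x}"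
      unfolding J_def by (intro has_integral_sum S has_integral_mult_right conv)
    then show ?thesis by (simp add: A_def sum_distrib_right mult.assoc)
  qed
  have pointwise: "norm (A (x - z) * k z) \<le> K * x ^ L * W * exp (x / 2) * exp (z / 2)"
    if z: "z \<in> {0..x}" for z
  proof -
    define a where "a = x - z"
    have a: "0 \<le> a" "a \<le> x" "0 \<le> z" "z \<le> x" using z by (auto simp: a_def)
    have summand: "a ^ L * (z ^ m / fact m) \<le> x ^ L * (2 ^ m * exp (a / 2))" if "m \<le> L" for m
    proof -
      \<comment> \<open>only \<open>a\<^sup>m\<close> has to be kept against the decay of the exponential; the other \<open>L\<close> powers go into \<open>x\<^sup>L\<close>\<close>
      have "a ^ L * z ^ m = a ^ m * (a ^ (L - m) * z ^ m)"
        using that by (simp add: power_add[symmetric] mult.assoc[symmetric])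
      also have "\<dots> \<le> a ^ m * (x ^ (L - m) * x ^ m)"
        using a x by (intro mult_left_mono mult_mono power_mono) auto
      also have "\<dots> = x ^ L * a ^ m"
        using that by (simp add: power_add[symmetric])
      finally have "a ^ L * z ^ m / fact m \<le> x ^ L * a ^ m / fact m"
        by (rule divide_right_mono) simp
      also have "x ^ L * a ^ m / fact m \<le> x ^ L * (2 ^ m * exp (a / 2))"
        using mult_left_mono[OF power_over_fact_le[OF a(1), of m], of "x ^ L"] x by simp
      finally show ?thesis by simp
    qed
    have "norm (A a * k z) \<le> (K * a ^ L) * (exp z *
        (\<Sum>m\<le>L. of_nat (Suc L choose Suc m) * norm w ^ Suc m * (z ^ m / fact m)))"
      unfolding norm_mult A_def
    proof (rule mult_mono)
      show "norm (k z) \<le> exp z * (\<Sum>m\<le>L. of_nat (Suc L choose Suc m) * norm w ^ Suc m * (z ^ m / fact m))"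
        using k_le[OF a(3)] w by simp
    qed (use A a K in auto)
    also have "\<dots> = K * exp z * (\<Sum>m\<le>L. of_nat (Suc L choose Suc m) * norm w ^ Suc m * (a ^ L * (z ^ m / fact m)))"
      unfolding sum_distrib_left by (intro sum.cong refl) (simp only: mult_ac)
    also have "\<dots> \<le> K * exp z * (\<Sum>m\<le>L. of_nat (Suc L choose Suc m) * norm w ^ Suc m * (x ^ L * (2 ^ m * exp (a / 2))))"
      using K by (intro mult_left_mono sum_mono summand) auto
    also have "\<dots> = K * x ^ L * W * (exp z * exp (a / 2))"
      unfolding W_def sum_distrib_left sum_distrib_right by (intro sum.cong refl) (simp only: mult_ac)
    also have "exp z * exp (a / 2) = exp (x / 2) * exp (z / 2)"
      unfolding exp_add[symmetric] a_def by (rule arg_cong[where f = exp]) (simp add: field_simps)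
    finally show ?thesis unfolding a_def by (simp only: mult.assoc)
  qed
  have exp_int: "((\<lambda>z. exp (z / 2)) has_integral 2 * exp (x / 2) - 2 * exp (0 / 2)) {0..x}"
  proof (rule fundamental_theorem_of_calculus)
    fix z
    have "((\<lambda>z. 2 * exp (z / 2)) has_real_derivative exp (z / 2)) (at z within {0..x})"
      by (auto intro!: derivative_eq_intros)
    then show "((\<lambda>z. 2 * exp (z / 2)) has_vector_derivative exp (z / 2)) (at z within {0..x})"
      by (simp add: has_real_derivative_iff_has_vector_derivative)
  qed (use x in simp)
  have J_le: "norm J \<le> K * x ^ L * (2 * W) * exp x"
  proof -
    have "norm (integral {0..x} (\<lambda>z. A (x - z) * k z)) \<le> integral {0..x} (\<lambda>z. K * x ^ L * W * exp (x / 2) * exp (z / 2))"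
      by (rule integral_norm_bound_integral)
         (use J exp_int pointwise in \<open>auto intro!: integrable_on_mult_right\<close>)
    then have "norm J \<le> K * x ^ L * W * exp (x / 2) * (2 * exp (x / 2) - 2)"
      using integral_unique[OF J] integral_unique[OF exp_int]
      by simp
    also have "\<dots> \<le> K * x ^ L * W * exp (x / 2) * (2 * exp (x / 2))"
      using K x W by (intro mult_left_mono mult_nonneg_nonneg) auto
    also have "\<dots> = K * x ^ L * (2 * W) * (exp (x / 2) * exp (x / 2))"
      by (simp only: mult_ac)
    also have "exp (x / 2) * exp (x / 2) = exp x"
      unfolding exp_add[symmetric] by simp
    finally show ?thesis .
  qed
  have "(\<Sum>n\<in>S. b n * of_real ((1 - lam n / x) ^ L) * exp (- of_real (lam n) * w))
      = exp (- of_real x * w) / of_real x ^ L * (A x + J)"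
  proof -
    have "A x + J = (\<Sum>n\<in>S. b n * (of_real (x - lam n) ^ L * exp (w * of_real (x - lam n))))"
      unfolding A_def J_def sum.distrib[symmetric]
    proof (intro sum.cong refl)
      fix n assume "n \<in> S"
      then have "max 0 (x - lam n) = x - lam n" using lam by (simp add: max_def)
      then show "b n * of_real (max 0 (x - lam n) ^ L) + b n * (of_real (x - lam n) ^ L * exp (w * of_real (x - lam n)) - of_real (x - lam n) ^ L)
        = b n * (of_real (x - lam n) ^ L * exp (w * of_real (x - lam n)))"
        by (simp only: of_real_power right_diff_distrib) simp
    qed
    moreover have "b n * of_real ((1 - lam n / x) ^ L) * exp (- of_real (lam n) * w)
        = exp (- of_real x * w) / of_real x ^ L * (b n * (of_real (x - lam n) ^ L * exp (w * of_real (x - lam n))))" for n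
    proof -
      have "1 - lam n / x = (x - lam n) / x" using x by (simp add: diff_divide_distrib)
      then have "of_real ((1 - lam n / x) ^ L) = (of_real (x - lam n) ^ L / of_real x ^ L :: complex)"
        by (simp only: power_divide of_real_divide of_real_power)
      moreover have "exp (- of_real (lam n) * w) = exp (- of_real x * w) * exp (w * of_real (x - lam n))"
        unfolding exp_add[symmetric] by (rule arg_cong[where f = exp]) (simp add: algebra_simps)
      ultimately show ?thesis by (simp only: times_divide_eq_left times_divide_eq_right mult_ac)
    qed
    ultimately show ?thesis by (simp only: sum_distrib_left)
  qed
  also have "norm \<dots> = exp (- x) / x ^ L * norm (A x + J)"
    using x w by (simp add: norm_mult norm_divide norm_power norm_exp_eq_Re)
  also have "\<dots> \<le> exp (- x) / x ^ L * (K * x ^ L + K * x ^ L * (2 * W) * exp x)"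
    using A[of x] J_le x
    by (intro mult_left_mono order_trans[OF norm_triangle_ineq] add_mono) (auto simp: A_def)
  also have "\<dots> = K * exp (- x) + K * (2 * W)"
    using x by (simp add: exp_minus field_simps)
  also have "\<dots> \<le> K * 1 + K * (2 * (1 + 2 * norm w) ^ Suc L)"
    using K x W by (intro add_mono mult_left_mono) auto
  also have "\<dots> = K * (1 + 2 * (1 + 2 * norm w) ^ Suc L)"
    by (simp only: distrib_left)
  finally show ?thesis .
qed

section \<open>Riesz means of integer order\<close>

definition freq_upto :: "(nat \<Rightarrow> real) \<Rightarrow> real \<Rightarrow> nat set" where
  "freq_upto lam x = {n. 1 \<le> n \<and> lam n \<le> x}"

lemma finite_freq_upto:
  assumes "frequency lam"
  shows "finite (freq_upto lam x)"
proof -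
  have "eventually (\<lambda>n. lam n > x) sequentially"
    using assms unfolding frequency_def filterlim_at_top_dense by blast
  then obtain N where "\<And>n. n \<ge> N \<Longrightarrow> lam n > x"
    by (auto simp: eventually_sequentially)
  then have "n \<le> N" if "n \<in> freq_upto lam x" for n
    using that by (metis (mono_tags) freq_upto_def linorder_linear mem_Collect_eq not_le)
  then have "freq_upto lam x \<subseteq> {..N}" by auto
  then show ?thesis by (rule finite_subset) simp
qed

lemma freq_upto_nonneg:
  assumes "frequency lam" "n \<in> freq_upto lam x"
  shows "0 \<le> lam n"
  using assms by (auto simp: frequency_def freq_upto_def)

lemma riesz_mean_eq:
  "riesz_mean lam l D x s = (\<Sum>n\<in>freq_upto lam x.
     D n * exp (- of_real (lam n) * s) * of_real (riesz_weight l (1 - lam n / x)))"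
  unfolding riesz_mean_def freq_upto_def by (intro sum.cong refl) (simp only: mult_ac)

lemma riesz_weight_of_nat:
  assumes "L \<ge> 1" "t \<ge> 0"
  shows "riesz_weight (real L) t = t ^ L"
  using assms by (cases "t = 0") (auto simp: riesz_weight_def powr_realpow power_0_left)

lemma riesz_weight_le_one:
  assumes "l \<ge> 0" "0 \<le> t" "t \<le> 1"
  shows "0 \<le> riesz_weight l t" "riesz_weight l t \<le> 1"
proof -
  show "0 \<le> riesz_weight l t" by (simp add: riesz_weight_def)
  have "t powr l \<le> 1 powr l" using assms by (intro powr_mono2) auto
  then show "riesz_weight l t \<le> 1" by (simp add: riesz_weight_def)
qed

text \<open>For large \<open>x\<close> the limit bounds the means, and below that only finitely many terms occur, with
  weights at most one.\<close>
lemma riesz_mean_bounded: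
  assumes lam: "frequency lam" and l: "l \<ge> 0"
    and lim: "((\<lambda>x. riesz_mean lam l D x s) \<longlongrightarrow> F) at_top"
  obtains K where "K \<ge> 0" "\<And>x. x \<ge> 0 \<Longrightarrow> norm (riesz_mean lam l D x s) \<le> K"
proof -
  have "eventually (\<lambda>x. dist (riesz_mean lam l D x s) F < 1) at_top"
    using lim by (rule tendstoD) simp
  then obtain X where X: "\<And>x. x \<ge> X \<Longrightarrow> dist (riesz_mean lam l D x s) F < 1"
    by (auto simp: eventually_at_top_linorder)
  define M where "M = (\<Sum>n\<in>freq_upto lam X. norm (D n * exp (- of_real (lam n) * s)))"
  have "M \<ge> 0" unfolding M_def by (intro sum_nonneg norm_ge_zero)
  show thesis
  proof (rule that[of "M + (norm F + 1)"])
    show "0 \<le> M + (norm F + 1)" using \<open>M \<ge> 0\<close> by simp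
    fix x :: real assume x: "x \<ge> 0"
    show "norm (riesz_mean lam l D x s) \<le> M + (norm F + 1)"
    proof (cases "x \<ge> X")
      case True
      have "norm (riesz_mean lam l D x s) \<le> norm F + dist (riesz_mean lam l D x s) F"
        unfolding dist_norm by (metis add.commute norm_triangle_sub)
      with X[OF True] \<open>M \<ge> 0\<close> show ?thesis by linarith
    next
      case False
      have "norm (riesz_mean lam l D x s) \<le> (\<Sum>n\<in>freq_upto lam x. norm (D n * exp (- of_real (lam n) * s)))"
        unfolding riesz_mean_eq
      proof (rule sum_norm_le)
        fix n assume n: "n \<in> freq_upto lam x"
        have "0 \<le> lam n" "lam n \<le> x"
          using n freq_upto_nonneg[OF lam n] by (auto simp: freq_upto_def)
        then have "0 \<le> 1 - lam n / x" "1 - lam n / x \<le> 1"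
          using x by (auto simp: divide_le_eq_1)
        note w = riesz_weight_le_one[OF l this]
        have "norm (D n * exp (- of_real (lam n) * s) * of_real (riesz_weight l (1 - lam n / x)))
            = norm (D n * exp (- of_real (lam n) * s)) * riesz_weight l (1 - lam n / x)"
          using w(1) by (simp only: norm_mult norm_of_real abs_of_nonneg)
        also have "\<dots> \<le> norm (D n * exp (- of_real (lam n) * s)) * 1"
          by (rule mult_left_mono[OF w(2) norm_ge_zero])
        finally show "norm (D n * exp (- of_real (lam n) * s) * of_real (riesz_weight l (1 - lam n / x)))
            \<le> norm (D n * exp (- of_real (lam n) * s))" by simp
      qed
      also have "\<dots> \<le> M"
        unfolding M_def using False
        by (intro sum_mono2 finite_freq_upto lam) (auto simp: freq_upto_def)
      finally show ?thesis using norm_ge_zero[of F] by linarith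
    qed
  qed
qed

text \<open>The Riesz weight of order \<open>L\<close> is a positive average of weights of order \<open>l\<close>: with the stated density,
  the integrand becomes \<open>(v - r)\<^sup>l (1 - v)\<close> to the power \<open>L - l - 1\<close> on \<open>[r, 1]\<close>, which an affine
  substitution maps to the Beta integral.\<close>
lemma riesz_weight_raise:
  fixes r l :: real and L :: nat
  assumes l: "0 \<le> l" "l < real L" and r: "0 \<le> r" "r \<le> 1"
  shows "((\<lambda>v. (if r \<le> v then riesz_weight l (1 - r / v) else 0) * (v powr l * (1 - v) powr (real L - l - 1)))
     has_integral (1 - r) ^ L * Beta (l + 1) (real L - l)) {0..1}"
    (is "(?f has_integral _) _")
proof (cases "r = 1")
  case True
  have "L \<noteq> 0" using l by auto
  have "(?f has_integral 0) {0..1}"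
    by (rule has_integral_spike_finite[of "{1}" _ _ "\<lambda>_. 0"]) (use True in auto)
  then show ?thesis using True \<open>L \<noteq> 0\<close> by (simp add: power_0_left)
next
  case False
  define m where "m = 1 / (1 - r)"
  define c where "c = - (r / (1 - r))"
  have d: "1 - r > 0" using False r by simp
  have m: "m > 0" using d by (simp add: m_def)
  have "((\<lambda>t. t powr (l + 1 - 1) * (1 - t) powr (real L - l - 1)) has_integral Beta (l + 1) (real L - l)) (cbox 0 1)"
    using has_integral_Beta_real[of "l + 1" "real L - l"] l by simp
  from has_integral_affinity'[OF this m, of c]
  have "((\<lambda>v. (m * v + c) powr l * (1 - (m * v + c)) powr (real L - l - 1)) has_integral
      (1 - r) * Beta (l + 1) (real L - l)) {(0 - c) / m..(1 - c) / m}"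
    using d by (simp add: m_def divide_inverse mult_ac)
  moreover have "(0 - c) / m = r" "(1 - c) / m = 1"
    using d by (auto simp: c_def m_def field_simps)
  ultimately have "((\<lambda>v. (m * v + c) powr l * (1 - (m * v + c)) powr (real L - l - 1)) has_integral
      (1 - r) * Beta (l + 1) (real L - l)) {r..1}" by simp
  then have "((\<lambda>v. (1 - r) powr (real L - 1) * ((m * v + c) powr l * (1 - (m * v + c)) powr (real L - l - 1))) has_integral
      (1 - r) powr (real L - 1) * ((1 - r) * Beta (l + 1) (real L - l))) {r..1}"
    by (rule has_integral_mult_right)
  moreover have "(1 - r) powr (real L - 1) * ((1 - r) * Beta (l + 1) (real L - l)) = (1 - r) ^ L * Beta (l + 1) (real L - l)"
  proof -
    have "(1 - r) powr (real L - 1) * (1 - r) = (1 - r) powr (real L - 1) * (1 - r) powr 1"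
      using d by simp
    also have "\<dots> = (1 - r) powr real L" unfolding powr_add[symmetric] by simp
    also have "\<dots> = (1 - r) ^ L" by (rule powr_realpow[OF d])
    finally show ?thesis by (simp only: mult.assoc[symmetric])
  qed
  ultimately have upper: "((\<lambda>v. (1 - r) powr (real L - 1) * ((m * v + c) powr l * (1 - (m * v + c)) powr (real L - l - 1)))
      has_integral (1 - r) ^ L * Beta (l + 1) (real L - l)) {r..1}" by (simp only:)
  have 1: "(?f has_integral (1 - r) ^ L * Beta (l + 1) (real L - l)) {r..1}"
  proof (rule has_integral_spike_finite[OF _ _ upper, of "{r, 1}"])
    fix v assume "v \<in> {r..1} - {r, 1}"
    then have v: "r < v" "v < 1" "0 < v" using r by auto
    have w: "riesz_weight l (1 - r / v) * v powr l = (v - r) powr l"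
    proof -
      have "riesz_weight l (1 - r / v) = (1 - r / v) powr l"
        using v by (simp add: riesz_weight_def)
      also have "\<dots> * v powr l = ((1 - r / v) * v) powr l"
        using v by (subst powr_mult) auto
      also have "(1 - r / v) * v = v - r" using v by (simp add: field_simps)
      finally show ?thesis .
    qed
    have a: "m * v + c = (v - r) / (1 - r)"
      by (simp add: m_def c_def diff_divide_distrib)
    have "(1 - v) / (1 - r) + (v - r) / (1 - r) = 1"
      unfolding add_divide_distrib[symmetric] using d by simp
    then have a': "1 - (v - r) / (1 - r) = (1 - v) / (1 - r)" by linarith
    have p: "(1 - r) powr (real L - 1) = (1 - r) powr l * (1 - r) powr (real L - l - 1)"
      unfolding powr_add[symmetric] by simp
    have "(1 - r) powr l \<noteq> 0" "(1 - r) powr (real L - l - 1) \<noteq> 0" using d by auto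
    then have "(1 - r) powr (real L - 1) * ((m * v + c) powr l * (1 - (m * v + c)) powr (real L - l - 1))
       = (v - r) powr l * (1 - v) powr (real L - l - 1)"
      unfolding a a' p using v d by (simp add: powr_divide)
    then show "?f v = (1 - r) powr (real L - 1) * ((m * v + c) powr l * (1 - (m * v + c)) powr (real L - l - 1))"
      using v w by (simp add: mult.assoc[symmetric])
  qed simp
  have 0: "(?f has_integral 0) {0..r}"
    by (rule has_integral_spike_finite[of "{r}" _ _ "\<lambda>_. 0"]) auto
  from has_integral_combine[OF r 0 1] show ?thesis by simp
qed

lemma riesz_mean_raise:
  fixes L :: nat
  assumes lam: "frequency lam" and l: "0 \<le> l" "l < real L" and x: "x > 0"
  shows "((\<lambda>v. of_real (v powr l * (1 - v) powr (real L - l - 1)) * riesz_mean lam l D (x * v) s)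
     has_integral of_real (Beta (l + 1) (real L - l)) * riesz_mean lam (real L) D x s) {0..1}"
proof -
  define c where "c n = D n * exp (- of_real (lam n) * s)" for n
  define \<omega> where "\<omega> v = v powr l * (1 - v) powr (real L - l - 1)" for v
  define u where "u n v = (if lam n / x \<le> v then riesz_weight l (1 - lam n / x / v) else 0)" for n v
  define B where "B = Beta (l + 1) (real L - l)"
  have L: "L \<ge> 1" using l by (cases L) auto
  have "((\<lambda>v. \<Sum>n\<in>freq_upto lam x. c n * of_real (u n v * \<omega> v)) has_integral
      (\<Sum>n\<in>freq_upto lam x. c n * of_real ((1 - lam n / x) ^ L * B))) {0..1}"
  proof (intro has_integral_sum finite_freq_upto lam has_integral_mult_right has_integral_of_real)
    fix n assume n: "n \<in> freq_upto lam x"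
    show "((\<lambda>v. u n v * \<omega> v) has_integral (1 - lam n / x) ^ L * B) {0..1}"
      unfolding u_def \<omega>_def B_def
      by (rule riesz_weight_raise[OF l])
         (use n freq_upto_nonneg[OF lam n] x in \<open>auto simp: freq_upto_def\<close>)
  qed
  moreover have "(\<Sum>n\<in>freq_upto lam x. c n * of_real ((1 - lam n / x) ^ L * B)) = of_real B * riesz_mean lam (real L) D x s"
    unfolding riesz_mean_eq sum_distrib_left
  proof (intro sum.cong refl)
    fix n assume n: "n \<in> freq_upto lam x"
    have "riesz_weight (real L) (1 - lam n / x) = (1 - lam n / x) ^ L"
      using n x by (intro riesz_weight_of_nat L) (auto simp: freq_upto_def)
    then show "c n * of_real ((1 - lam n / x) ^ L * B) = of_real B *
        (D n * exp (- of_real (lam n) * s) * of_real (riesz_weight (real L) (1 - lam n / x)))"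
      by (simp only: c_def of_real_mult mult_ac)
  qed
  ultimately have "((\<lambda>v. \<Sum>n\<in>freq_upto lam x. c n * of_real (u n v * \<omega> v)) has_integral
      of_real B * riesz_mean lam (real L) D x s) {0..1}" by (simp only:)
  then have "((\<lambda>v. of_real (\<omega> v) * riesz_mean lam l D (x * v) s) has_integral
      of_real B * riesz_mean lam (real L) D x s) {0..1}"
  proof (rule has_integral_eq[rotated])
    fix v :: real assume v: "v \<in> {0..1}"
    have "x * v \<le> x" using v x by (simp add: mult_left_le)
    then have sub: "freq_upto lam (x * v) \<subseteq> freq_upto lam x"
      by (auto simp: freq_upto_def)
    have "(\<Sum>n\<in>freq_upto lam x. c n * of_real (u n v * \<omega> v)) = (\<Sum>n\<in>freq_upto lam (x * v). c n * of_real (u n v * \<omega> v))"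
    proof (rule sum.mono_neutral_right[OF finite_freq_upto[OF lam] sub], rule ballI)
      fix n assume "n \<in> freq_upto lam x - freq_upto lam (x * v)"
      then have "\<not> lam n / x \<le> v" using x by (auto simp: freq_upto_def field_simps)
      then show "c n * of_real (u n v * \<omega> v) = 0" by (simp add: u_def)
    qed
    also have "\<dots> = of_real (\<omega> v) * riesz_mean lam l D (x * v) s"
      unfolding riesz_mean_eq sum_distrib_left
    proof (intro sum.cong refl)
      fix n assume "n \<in> freq_upto lam (x * v)"
      then have "lam n / x \<le> v" using x by (auto simp: freq_upto_def field_simps)
      then have "u n v = riesz_weight l (1 - lam n / (x * v))" by (simp add: u_def)
      then show "c n * of_real (u n v * \<omega> v) = of_real (\<omega> v) *
          (D n * exp (- of_real (lam n) * s) * of_real (riesz_weight l (1 - lam n / (x * v))))"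
        by (simp only: c_def of_real_mult mult_ac)
    qed
    finally show "(\<Sum>n\<in>freq_upto lam x. c n * of_real (u n v * \<omega> v)) = of_real (\<omega> v) * riesz_mean lam l D (x * v) s" .
  qed
  then show ?thesis unfolding \<omega>_def B_def .
qed

text \<open>Averaging preserves limits and bounds. An integer order is needed since the Taylor
  argument above requires a natural number \<open>L\<close>.\<close>
lemma riesz_summable_raise_order:
  fixes L :: nat
  assumes lam: "frequency lam" and l: "0 \<le> l" "l < real L"
    and lim: "((\<lambda>x. riesz_mean lam l D x s) \<longlongrightarrow> F) at_top"
  shows "(\<lambda>N. riesz_mean lam (real L) D (real (Suc N)) s) \<longlonglongrightarrow> F" (is ?lim)
    and "\<exists>K\<ge>0. \<forall>x>0. norm (riesz_mean lam (real L) D x s) \<le> K" (is ?bdd)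
proof -
  define \<omega> where "\<omega> v = v powr l * (1 - v) powr (real L - l - 1)" for v
  define B where "B = Beta (l + 1) (real L - l)"
  have B: "B > 0"
    unfolding B_def Beta_def using l by (intro divide_pos_pos mult_pos_pos Gamma_real_pos) auto
  have \<omega>: "(\<omega> has_integral B) {0..1}"
    unfolding \<omega>_def B_def using has_integral_Beta_real[of "l + 1" "real L - l"] l by simp
  have \<omega>_nonneg: "\<omega> v \<ge> 0" for v by (simp add: \<omega>_def)
  have raise: "((\<lambda>v. of_real (\<omega> v) * riesz_mean lam l D (x * v) s)
     has_integral of_real B * riesz_mean lam (real L) D x s) {0..1}" if "x > 0" for x
    unfolding \<omega>_def B_def by (rule riesz_mean_raise[OF lam l that])
  obtain K where K: "K \<ge> 0" "\<And>x. x \<ge> 0 \<Longrightarrow> norm (riesz_mean lam l D x s) \<le> K"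
    by (rule riesz_mean_bounded[OF lam l(1) lim]) (rule that)
  have dom: "norm (of_real (\<omega> v) * riesz_mean lam l D (x * v) s) \<le> \<omega> v * K" if "x > 0" "v \<in> {0..1}" for x v
    unfolding norm_mult using that \<omega>_nonneg[of v] by (auto intro!: mult_left_mono K)
  have \<omega>K: "((\<lambda>v. \<omega> v * K) has_integral B * K) {0..1}"
    by (rule has_integral_mult_left[OF \<omega>])
  show ?bdd
  proof (intro exI[of _ K] conjI allI impI K(1))
    fix x :: real assume x: "x > 0"
    have "norm (integral {0..1} (\<lambda>v. of_real (\<omega> v) * riesz_mean lam l D (x * v) s)) \<le> integral {0..1} (\<lambda>v. \<omega> v * K)"
      using raise[OF x] \<omega>K dom[OF x] by (intro integral_norm_bound_integral) auto
    then have "norm (of_real B * riesz_mean lam (real L) D x s) \<le> B * K"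
      unfolding integral_unique[OF raise[OF x]] integral_unique[OF \<omega>K] .
    then show "norm (riesz_mean lam (real L) D x s) \<le> K"
      using B by (simp add: norm_mult)
  qed
  have "(\<lambda>N. integral {0..1} (\<lambda>v. of_real (\<omega> v) * riesz_mean lam l D (real (Suc N) * v) s))
      \<longlonglongrightarrow> integral {0..1} (\<lambda>v. of_real (\<omega> v) * F)"
  proof (rule dominated_convergence(2))
    fix v :: real assume v: "v \<in> {0..1}"
    show "(\<lambda>N. of_real (\<omega> v) * riesz_mean lam l D (real (Suc N) * v) s) \<longlonglongrightarrow> of_real (\<omega> v) * F"
    proof (cases "v = 0")
      case True
      then have "\<omega> v = 0" by (simp add: \<omega>_def)
      then show ?thesis by simp
    next
      case False
      then have "v > 0" using v by simp
      then have "filterlim (\<lambda>N. real (Suc N) * v) at_top sequentially"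
        by real_asymp
      then show ?thesis by (intro tendsto_mult_left filterlim_compose[OF lim])
    qed
  next
    fix N
    show "(\<lambda>v. of_real (\<omega> v) * riesz_mean lam l D (real (Suc N) * v) s) integrable_on {0..1}"
      by (rule has_integral_integrable[OF raise]) simp
  next
    show "(\<lambda>v. \<omega> v * K) integrable_on {0..1}" by (rule has_integral_integrable[OF \<omega>K])
  qed (intro dom, auto)
  moreover have "integral {0..1} (\<lambda>v. of_real (\<omega> v) * riesz_mean lam l D (real (Suc N) * v) s)
      = of_real B * riesz_mean lam (real L) D (real (Suc N)) s" for N
    by (rule integral_unique[OF raise]) simp
  moreover have "integral {0..1} (\<lambda>v. of_real (\<omega> v) * F) = of_real B * F"
    by (intro integral_unique has_integral_mult_left has_integral_of_real \<omega>)
  ultimately have "(\<lambda>N. of_real B * riesz_mean lam (real L) D (real (Suc N)) s) \<longlonglongrightarrow> of_real B * F"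
    by (simp only:)
  from tendsto_mult_left[OF this, of "inverse (of_real B)"] show ?lim
    using B by (simp add: field_simps)
qed

text \<open>Boundedness at a single point \<open>s\<close> controls a whole vertical line to its right.\<close>
lemma riesz_mean_polynomial_bound:
  fixes L :: nat
  assumes lam: "frequency lam" and L: "L \<ge> 1" and K: "K \<ge> 0"
    and bdd: "\<And>x. x > 0 \<Longrightarrow> norm (riesz_mean lam (real L) D x s) \<le> K"
    and x: "x > 0" and w: "Re w = 1"
  shows "norm (riesz_mean lam (real L) D x (s + w)) \<le> K * (1 + 2 * (1 + 2 * norm w) ^ Suc L)"
proof -
  define b where "b n = D n * exp (- of_real (lam n) * s)" for n
  have wt: "riesz_weight (real L) (1 - lam n / v) = (1 - lam n / v) ^ L"
    if "n \<in> freq_upto lam v" "v > 0" for n v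
    using that by (intro riesz_weight_of_nat L) (auto simp: freq_upto_def)
  have "riesz_mean lam (real L) D x (s + w) =
      (\<Sum>n\<in>freq_upto lam x. b n * of_real ((1 - lam n / x) ^ L) * exp (- of_real (lam n) * w))"
    unfolding riesz_mean_eq
  proof (intro sum.cong refl)
    fix n assume "n \<in> freq_upto lam x"
    moreover have "exp (- of_real (lam n) * (s + w)) = exp (- of_real (lam n) * s) * exp (- of_real (lam n) * w)"
      unfolding exp_add[symmetric] by (simp only: distrib_left)
    ultimately show "D n * exp (- of_real (lam n) * (s + w)) * of_real (riesz_weight (real L) (1 - lam n / x))
        = b n * of_real ((1 - lam n / x) ^ L) * exp (- of_real (lam n) * w)"
      by (simp only: b_def wt[OF _ x] mult_ac)
  qed
  also have "norm \<dots> \<le> K * (1 + 2 * (1 + 2 * norm w) ^ Suc L)"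
  proof (rule twisted_riesz_sum_bound[OF finite_freq_upto[OF lam] L x _ w K])
    fix n assume "n \<in> freq_upto lam x"
    then show "0 \<le> lam n \<and> lam n \<le> x"
      using freq_upto_nonneg[OF lam] by (auto simp: freq_upto_def)
  next
    fix v :: real assume v: "0 \<le> v" "v \<le> x"
    have L0: "(0::real) ^ L = 0" using L by (simp add: power_0_left)
    have sub: "freq_upto lam v \<subseteq> freq_upto lam x"
      using v by (auto simp: freq_upto_def)
    have "(\<Sum>n\<in>freq_upto lam x. b n * of_real (max 0 (v - lam n) ^ L)) =
        (\<Sum>n\<in>freq_upto lam v. b n * of_real (max 0 (v - lam n) ^ L))"
    proof (rule sum.mono_neutral_right[OF finite_freq_upto[OF lam] sub], rule ballI)
      fix n assume "n \<in> freq_upto lam x - freq_upto lam v"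
      then have "max 0 (v - lam n) = 0" by (auto simp: freq_upto_def)
      then show "b n * of_real (max 0 (v - lam n) ^ L) = 0"
        by (simp only: L0 of_real_0 mult_zero_right)
    qed
    also have "\<dots> = of_real (v ^ L) * riesz_mean lam (real L) D v s"
      unfolding riesz_mean_eq sum_distrib_left
    proof (intro sum.cong refl)
      fix n assume n: "n \<in> freq_upto lam v"
      have n': "0 \<le> lam n" "lam n \<le> v"
        using n freq_upto_nonneg[OF lam n] by (auto simp: freq_upto_def)
      have "max 0 (v - lam n) ^ L = v ^ L * riesz_weight (real L) (1 - lam n / v)"
      proof (cases "v = 0")
        case True
        then show ?thesis using n' L0 by simp
      next
        case False
        then have "v > 0" using v by simp
        have "v ^ L * (1 - lam n / v) ^ L = (v * (1 - lam n / v)) ^ L"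
          by (rule power_mult_distrib[symmetric])
        also have "v * (1 - lam n / v) = max 0 (v - lam n)"
          using n' \<open>v > 0\<close> by (simp add: field_simps)
        finally show ?thesis by (simp only: wt[OF n \<open>v > 0\<close>])
      qed
      then show "b n * of_real (max 0 (v - lam n) ^ L) = of_real (v ^ L) *
          (D n * exp (- of_real (lam n) * s) * of_real (riesz_weight (real L) (1 - lam n / v)))"
        by (simp only: b_def of_real_mult mult_ac)
    qed
    also have "norm \<dots> \<le> K * v ^ L"
    proof (cases "v = 0")
      case True
      then have "v ^ L = 0" using L by (simp add: power_0_left)
      then show ?thesis by (simp only: of_real_0 mult_zero_left mult_zero_right norm_zero order_refl)
    next
      case False
      then have "v > 0" using v by simp
      have "norm (of_real (v ^ L) * riesz_mean lam (real L) D v s) = norm (riesz_mean lam (real L) D v s) * v ^ L"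
        using v by (simp only: norm_mult norm_of_real abs_of_nonneg zero_le_power mult.commute)
      also have "\<dots> \<le> K * v ^ L"
        by (rule mult_right_mono[OF bdd[OF \<open>v > 0\<close>]]) (use v in simp)
      finally show ?thesis .
    qed
    finally show "norm (\<Sum>n\<in>freq_upto lam x. b n * of_real (max 0 (v - lam n) ^ L)) \<le> K * v ^ L" .
  qed
  finally show ?thesis .
qed

section \<open>Recovering and bounding a coefficient\<close>

lemma eps_pos:
  assumes lam: "frequency lam" and n: "n \<ge> 1"
  shows "0 < eps lam n" "eps lam n \<le> 1"
proof -
  have mono: "lam i < lam j" if "1 \<le> i" "i < j" for i j
    using lam that by (auto simp: frequency_def strict_mono_on_def)
  show "0 < eps lam n"
    using mono[of n "n + 1"] mono[of "n - 1" n] mono[of 1 2] n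
    by (cases "n = 1") (auto simp: eps_def)
  show "eps lam n \<le> 1"
    by (simp add: eps_def)
qed

lemma eps_le_gap:
  assumes lam: "frequency lam" and n: "n \<ge> 1" and m: "m \<ge> 1" "m \<noteq> n"
  shows "eps lam n \<le> \<bar>lam n - lam m\<bar>"
proof -
  have mono: "lam i \<le> lam j" if "1 \<le> i" "i \<le> j" for i j
    using lam that by (auto simp: frequency_def strict_mono_on_def le_less)
  show ?thesis
  proof (cases "m < n")
    case True
    then have "eps lam n \<le> lam n - lam (n - 1)" using m by (simp add: eps_def)
    also have "\<dots> \<le> lam n - lam m" using mono[of m "n - 1"] True m by simp
    finally show ?thesis by simp
  next
    case False
    then have "n + 1 \<le> m" using m by simp
    have "eps lam n \<le> lam (n + 1) - lam n"
      by (cases "n = 1") (auto simp: eps_def numeral_2_eq_2)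
    also have "\<dots> \<le> lam m - lam n" using mono[OF _ \<open>n + 1 \<le> m\<close>] by simp
    finally show ?thesis by simp
  qed
qed

lemma half_plane_zero: "half_plane 0 = {s. 0 < Re s}"
  by (simp add: half_plane_def zero_ereal_def)

text \<open>Since \<open>\<epsilon> \<le> 1\<close>, \<open>1 + \<bar>z\<bar> \<le> (1 + \<epsilon> \<bar>z\<bar>) / \<epsilon>\<close>. This step is the origin of the power of
  \<open>1 / \<epsilon>\<^sub>n\<close> in the theorem.\<close>
lemma growth_absorbed_by_decay:
  assumes \<epsilon>: "0 < \<epsilon>" "\<epsilon> \<le> 1" and a: "0 \<le> a" "a + 2 \<le> real N"
  shows "(1 + norm z) powr a / (1 + \<epsilon> * norm z) ^ N \<le> (1 / \<epsilon>) powr a / (1 + (\<epsilon> * Im z)\<^sup>2)"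
proof -
  define X where "X = 1 + \<epsilon> * norm z"
  have X: "X \<ge> 1" using \<epsilon> by (simp add: X_def)
  have "1 + norm z \<le> (1 / \<epsilon>) * X" using \<epsilon> by (simp add: X_def distrib_left)
  then have "(1 + norm z) powr a \<le> ((1 / \<epsilon>) * X) powr a"
    using a by (intro powr_mono2) auto
  also have "\<dots> = (1 / \<epsilon>) powr a * X powr a"
    by (rule powr_mult)
  finally have 1: "(1 + norm z) powr a \<le> (1 / \<epsilon>) powr a * X powr a" .
  have "X powr a * X\<^sup>2 = X powr (a + 2)"
    using X by (simp add: powr_add)
  also have "\<dots> \<le> X powr real N" using X a by (intro powr_mono) auto
  also have "\<dots> = X ^ N" using X by (simp add: powr_realpow)
  finally have 2: "X powr a / X ^ N \<le> 1 / X\<^sup>2"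
    using X by (simp add: field_simps)
  have 3: "1 + (\<epsilon> * Im z)\<^sup>2 \<le> X\<^sup>2"
  proof -
    have "\<epsilon> * \<bar>Im z\<bar> \<le> \<epsilon> * norm z" using \<epsilon> abs_Im_le_cmod[of z] by (intro mult_left_mono) auto
    moreover have "0 \<le> \<epsilon> * \<bar>Im z\<bar>" using \<epsilon> by simp
    ultimately have "(\<epsilon> * \<bar>Im z\<bar>)\<^sup>2 \<le> (\<epsilon> * norm z)\<^sup>2" "0 \<le> \<epsilon> * norm z"
      by (auto intro: power_mono)
    then show ?thesis by (simp add: X_def power2_sum power_mult_distrib)
  qed
  have pos: "1 + (\<epsilon> * Im z)\<^sup>2 > 0" by (auto intro: add_pos_nonneg)
  have "(1 + norm z) powr a / X ^ N \<le> (1 / \<epsilon>) powr a * X powr a / X ^ N"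
    using 1 X by (intro divide_right_mono) auto
  also have "\<dots> = (1 / \<epsilon>) powr a * (X powr a / X ^ N)" by simp
  also have "\<dots> \<le> (1 / \<epsilon>) powr a * (1 / X\<^sup>2)"
    using 2 by (intro mult_left_mono) auto
  also have "\<dots> \<le> (1 / \<epsilon>) powr a * (1 / (1 + (\<epsilon> * Im z)\<^sup>2))"
    using 3 X pos by (intro mult_left_mono divide_left_mono mult_pos_pos) auto
  finally show ?thesis by (simp add: X_def)
qed

lemma inverse_scaled_square_le:
  fixes \<epsilon> t :: real
  assumes "0 < \<epsilon>" "\<epsilon> \<le> 1"
  shows "1 / (1 + (\<epsilon> * t)\<^sup>2) \<le> (1 / \<epsilon>\<^sup>2) / (1 + t\<^sup>2)"
proof -
  have "\<epsilon>\<^sup>2 \<le> 1" using assms by (simp add: power_le_one)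
  then have le: "\<epsilon>\<^sup>2 * (1 + t\<^sup>2) \<le> 1 + (\<epsilon> * t)\<^sup>2"
    by (simp add: power_mult_distrib distrib_left)
  have "1 + t\<^sup>2 > 0" "1 + (\<epsilon> * t)\<^sup>2 > 0" by (auto intro: add_pos_nonneg)
  then have "1 / (1 + (\<epsilon> * t)\<^sup>2) \<le> 1 / (\<epsilon>\<^sup>2 * (1 + t\<^sup>2))"
    using le assms by (intro divide_left_mono mult_pos_pos) auto
  then show ?thesis by simp
qed

lemma tempered_kernel_bound:
  assumes \<epsilon>: "0 < \<epsilon>" "\<epsilon> \<le> 1" and pq: "p > 0" "q > 0" and a: "0 \<le> a" "a + 2 \<le> real (2 * p)"
    and z: "Re z \<ge> 0" and h: "norm h \<le> M * (1 + norm z) powr a" and M: "M \<ge> 0"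
  shows "norm (h * test_kernel p q (of_real \<epsilon> * z) * exp (of_real y * z)) \<le>
    M * (8 * real p) ^ (2 * p) * (1 / \<epsilon>) powr a * exp ((y + \<epsilon>) * Re z) / (1 + (\<epsilon> * Im z)\<^sup>2)"
proof -
  define P where "P = (8 * real p) ^ (2 * p)"
  have P: "P \<ge> 0" by (simp add: P_def)
  have t: "norm (test_kernel p q (of_real \<epsilon> * z)) \<le> P * exp (\<epsilon> * Re z) / (1 + \<epsilon> * norm z) ^ (2 * p)"
    using norm_test_kernel_le[OF pq, of "of_real \<epsilon> * z"] \<epsilon> z by (simp add: norm_mult P_def)
  have "norm (h * test_kernel p q (of_real \<epsilon> * z) * exp (of_real y * z))
     = norm h * norm (test_kernel p q (of_real \<epsilon> * z)) * exp (y * Re z)"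
    by (simp add: norm_mult norm_exp_eq_Re)
  also have "\<dots> \<le> (M * (1 + norm z) powr a) * (P * exp (\<epsilon> * Re z) / (1 + \<epsilon> * norm z) ^ (2 * p)) * exp (y * Re z)"
    using h t M by (intro mult_right_mono mult_mono) auto
  also have "\<dots> = M * P * (exp (y * Re z) * exp (\<epsilon> * Re z)) * ((1 + norm z) powr a / (1 + \<epsilon> * norm z) ^ (2 * p))"
    by simp
  also have "\<dots> \<le> M * P * (exp (y * Re z) * exp (\<epsilon> * Re z)) * ((1 / \<epsilon>) powr a / (1 + (\<epsilon> * Im z)\<^sup>2))"
    using M P by (intro mult_left_mono growth_absorbed_by_decay[OF \<epsilon> a]) auto
  also have "\<dots> = M * P * (1 / \<epsilon>) powr a * exp ((y + \<epsilon>) * Re z) / (1 + (\<epsilon> * Im z)\<^sup>2)"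
    by (simp add: exp_add[symmetric] distrib_right)
  finally show ?thesis by (simp only: P_def)
qed

lemma integral_inverse_scaled_square:
  fixes \<epsilon> :: real
  assumes "0 < \<epsilon>"
  shows "integrable lborel (\<lambda>t. 1 / (1 + (\<epsilon> * t)\<^sup>2))"
    and "(LINT t|lborel. 1 / (1 + (\<epsilon> * t)\<^sup>2)) = (LINT t|lborel. 1 / (1 + t\<^sup>2)) / \<epsilon>"
proof -
  show "integrable lborel (\<lambda>t. 1 / (1 + (\<epsilon> * t)\<^sup>2))"
    using lborel_integrable_real_affine[OF integrable_inverse_one_plus_square, of \<epsilon> 0] assms by simp
  show "(LINT t|lborel. 1 / (1 + (\<epsilon> * t)\<^sup>2)) = (LINT t|lborel. 1 / (1 + t\<^sup>2)) / \<epsilon>"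
    using lborel_integral_real_affine[of \<epsilon> "\<lambda>t. 1 / (1 + t\<^sup>2)" 0] assms by (simp add: field_simps)
qed

lemma integrable_exp_test_kernel:
  assumes \<epsilon>: "0 < \<epsilon>" "\<epsilon> \<le> 1" and pq: "p > 0" "q > 0" and c: "c \<ge> 0"
  shows "integrable lborel (\<lambda>t. test_kernel p q (of_real \<epsilon> * Complex c t) * exp (of_real y * Complex c t))"
proof (rule integrable_dominated_by_inverse_square)
  show "continuous_on UNIV (\<lambda>t. test_kernel p q (of_real \<epsilon> * Complex c t) * exp (of_real y * Complex c t))"
    using pq by (intro continuous_on_vertical_line[where S = UNIV] test_kernel_holomorphic holomorphic_intros) auto
  fix t
  have "norm (1 * test_kernel p q (of_real \<epsilon> * Complex c t) * exp (of_real y * Complex c t)) \<le>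
    1 * (8 * real p) ^ (2 * p) * (1 / \<epsilon>) powr 0 * exp ((y + \<epsilon>) * Re (Complex c t)) / (1 + (\<epsilon> * Im (Complex c t))\<^sup>2)"
  proof (rule tempered_kernel_bound[OF \<epsilon> pq])
    have "1 + norm (Complex c t) > 0" by (intro add_pos_nonneg) auto
    then show "norm (1::complex) \<le> 1 * (1 + norm (Complex c t)) powr 0" by simp
  qed (use pq c in auto)
  also have "\<dots> = (8 * real p) ^ (2 * p) * exp ((y + \<epsilon>) * c) * (1 / (1 + (\<epsilon> * t)\<^sup>2))"
    using \<epsilon> by simp
  also have "\<dots> \<le> (8 * real p) ^ (2 * p) * exp ((y + \<epsilon>) * c) * ((1 / \<epsilon>\<^sup>2) / (1 + t\<^sup>2))"
    by (intro mult_left_mono inverse_scaled_square_le \<epsilon>) auto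
  finally show "norm (test_kernel p q (of_real \<epsilon> * Complex c t) * exp (of_real y * Complex c t)) \<le>
     (8 * real p) ^ (2 * p) * exp ((y + \<epsilon>) * c) * (1 / \<epsilon>\<^sup>2) / (1 + t\<^sup>2)" by simp
qed

text \<open>The frequencies \<open>lam m\<close> with \<open>m \<noteq> n\<close> do not meet the interior of the support of the bump
  centred at \<open>lam n\<close>, so only the term with index \<open>n\<close> survives.\<close>
lemma integral_riesz_mean_test_kernel:
  assumes lam: "frequency lam" and n: "n \<in> freq_upto lam x"
    and \<epsilon>: "\<epsilon> = eps lam n" and pq: "p > 0" "q > 0" and c: "c \<ge> 0"
  shows "(LINT t|lborel. riesz_mean lam l D x (Complex c t) * test_kernel p q (of_real \<epsilon> * Complex c t)
            * exp (of_real (lam n) * Complex c t))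
     = D n * of_real (riesz_weight l (1 - lam n / x)) * kernel_mass p q \<epsilon>"
proof -
  have n1: "n \<ge> 1" using n by (simp add: freq_upto_def)
  have \<epsilon>': "0 < \<epsilon>" "\<epsilon> \<le> 1" using eps_pos[OF lam n1] \<epsilon> by auto
  define a where "a m = D m * of_real (riesz_weight l (1 - lam m / x))" for m
  define T where "T m t = test_kernel p q (of_real \<epsilon> * Complex c t) * exp (of_real (lam n - lam m) * Complex c t)" for m t
  have T_int: "(LINT t|lborel. T m t) = (if m = n then kernel_mass p q \<epsilon> else 0)" if "m \<in> freq_upto lam x" for m
  proof (cases "m = n")
    case True
    then show ?thesis
      unfolding T_def using integral_test_kernel_line[OF pq \<epsilon>'] by simp
  next
    case False
    have "\<epsilon> \<le> \<bar>lam n - lam m\<bar>"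
      unfolding \<epsilon> by (rule eps_le_gap[OF lam n1 _ False]) (use that in \<open>simp add: freq_upto_def\<close>)
    from integral_exp_test_kernel_vanishes[OF pq \<epsilon>' this] show ?thesis
      unfolding T_def using False by (simp only: mult.commute if_False)
  qed
  have "riesz_mean lam l D x (Complex c t) * test_kernel p q (of_real \<epsilon> * Complex c t) * exp (of_real (lam n) * Complex c t)
      = (\<Sum>m\<in>freq_upto lam x. a m * T m t)" for t
    unfolding riesz_mean_eq sum_distrib_right
  proof (intro sum.cong refl)
    fix m
    have "exp (of_real (lam n - lam m) * Complex c t) = exp (- of_real (lam m) * Complex c t) * exp (of_real (lam n) * Complex c t)"
      unfolding exp_add[symmetric] by (rule arg_cong[where f = exp]) (simp add: left_diff_distrib)
    then show "D m * exp (- of_real (lam m) * Complex c t) * of_real (riesz_weight l (1 - lam m / x)) *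
        test_kernel p q (of_real \<epsilon> * Complex c t) * exp (of_real (lam n) * Complex c t) = a m * T m t"
      by (simp only: a_def T_def mult_ac)
  qed
  then have "(LINT t|lborel. riesz_mean lam l D x (Complex c t) * test_kernel p q (of_real \<epsilon> * Complex c t)
            * exp (of_real (lam n) * Complex c t)) = (LINT t|lborel. (\<Sum>m\<in>freq_upto lam x. a m * T m t))"
    by (simp only:)
  also have "\<dots> = (\<Sum>m\<in>freq_upto lam x. (LINT t|lborel. a m * T m t))"
    unfolding T_def
    by (intro Bochner_Integration.integral_sum integrable_mult_right integrable_exp_test_kernel \<epsilon>' pq c)
  also have "\<dots> = (\<Sum>m\<in>freq_upto lam x. a m * (if m = n then kernel_mass p q \<epsilon> else 0))"
    by (intro sum.cong refl) (simp only: integral_mult_right_zero T_int)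
  also have "\<dots> = (\<Sum>m\<in>freq_upto lam x. if m = n then a n * kernel_mass p q \<epsilon> else 0)"
    by (intro sum.cong refl) auto
  also have "\<dots> = a n * kernel_mass p q \<epsilon>"
    using n finite_freq_upto[OF lam] by simp
  finally show ?thesis by (simp only: a_def)
qed

text \<open>Passage to the limit \<open>x \<rightarrow> \<infinity>\<close> in the identity for Riesz means, on a line to the right of
  the abscissa. The exponent \<open>q\<close> depends on the series through the order of summability, but the
  estimates for this kernel that follow do not involve \<open>q\<close>.\<close>
lemma coefficient_integral_representation:
  assumes lam: "frequency lam" and n: "n \<ge> 1" and ext: "is_limit_extension lam D f"
    and p: "p > 0" and \<epsilon>: "\<epsilon> = eps lam n"
  shows "\<exists>q>0. \<exists>c>0. (LINT t|lborel. f (Complex c t) * test_kernel p q (of_real \<epsilon> * Complex c t)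
            * exp (of_real (lam n) * Complex c t)) = D n * kernel_mass p q \<epsilon>"
proof -
  have \<epsilon>': "0 < \<epsilon>" "\<epsilon> \<le> 1" using eps_pos[OF lam n] \<epsilon> by auto
  obtain l where l: "l \<ge> 0" and absc: "riesz_abscissa lam l D < \<infinity>"
    and lim: "\<And>s. s \<in> half_plane (riesz_abscissa lam l D) \<Longrightarrow> s \<in> half_plane 0 \<Longrightarrow>
       ((\<lambda>x. riesz_mean lam l D x s) \<longlongrightarrow> f s) at_top"
    and hol: "f holomorphic_on half_plane 0"
    using ext unfolding is_limit_extension_def by blast
  obtain j :: nat where j: "riesz_abscissa lam l D < ereal (real j)"
    using absc less_PInf_Ex_of_nat by auto
  define \<sigma> where "\<sigma> = real j + 1"
  have \<sigma>: "\<sigma> > 0" by (simp add: \<sigma>_def)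
  have lim': "((\<lambda>x. riesz_mean lam l D x s) \<longlongrightarrow> f s) at_top" if "Re s \<ge> \<sigma>" for s
  proof (rule lim)
    have "riesz_abscissa lam l D < ereal (Re s)"
      by (rule less_trans[OF j]) (use that in \<open>simp add: \<sigma>_def\<close>)
    then show "s \<in> half_plane (riesz_abscissa lam l D)" by (simp add: half_plane_def)
    show "s \<in> half_plane 0" using that \<sigma> by (simp add: half_plane_zero)
  qed
  define L where "L = nat \<lfloor>l\<rfloor> + 1"
  have L: "L \<ge> 1" "l < real L" unfolding L_def using l by linarith+
  note raise = riesz_summable_raise_order[OF lam l L(2) lim']
  obtain K where K: "K \<ge> 0" "\<And>x. x > 0 \<Longrightarrow> norm (riesz_mean lam (real L) D x (of_real \<sigma>)) \<le> K"
    using raise(2)[of "of_real \<sigma>"] by auto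
  \<comment> \<open>convergence at \<open>\<sigma>\<close> gives the bound on the line \<open>Re s = \<sigma> + 1\<close>; the kernel must outweigh the
    power \<open>L + 1\<close> by two more powers, and \<open>2 q \<ge> L + 3\<close> because \<open>L \<ge> 1\<close>\<close>
  define c where "c = \<sigma> + 1"
  define q where "q = L + 1"
  have q: "q > 0" by (simp add: q_def)
  have c: "c > 0" using \<sigma> by (simp add: c_def)
  define M where "M = K * (3 * 2 ^ Suc L)"
  have M: "M \<ge> 0" using K by (simp add: M_def)
  have mean_le: "norm (riesz_mean lam (real L) D x (Complex c t)) \<le> M * (1 + norm (Complex c t)) powr real (Suc L)"
    if x: "x > 0" for x t
  proof -
    define w where "w = Complex 1 t"
    have cw: "Complex c t = of_real \<sigma> + w" by (simp add: complex_eq_iff c_def w_def)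
    have w: "Re w = 1" by (simp add: w_def)
    have "norm w \<le> norm (Complex c t)"
      unfolding w_def c_def complex_norm using \<sigma> by (intro real_sqrt_le_mono add_right_mono power_mono) auto
    then have le: "1 + 2 * norm w \<le> 2 * (1 + norm (Complex c t))" by simp
    have "norm (riesz_mean lam (real L) D x (Complex c t)) \<le> K * (1 + 2 * (1 + 2 * norm w) ^ Suc L)"
      unfolding cw by (rule riesz_mean_polynomial_bound[OF lam L(1) K x w])
    also have "\<dots> \<le> K * (3 * (1 + 2 * norm w) ^ Suc L)"
    proof (rule mult_left_mono[OF _ K(1)])
      have "1 \<le> (1 + 2 * norm w) ^ Suc L" by (rule one_le_power) simp
      then show "1 + 2 * (1 + 2 * norm w) ^ Suc L \<le> 3 * (1 + 2 * norm w) ^ Suc L" by linarith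
    qed
    also have "\<dots> \<le> K * (3 * (2 * (1 + norm (Complex c t))) ^ Suc L)"
      by (rule mult_left_mono[OF _ K(1)], rule mult_left_mono, rule power_mono[OF le]) auto
    also have "\<dots> = M * (1 + norm (Complex c t)) ^ Suc L"
      unfolding M_def power_mult_distrib by (simp only: mult_ac)
    also have "(1 + norm (Complex c t)) ^ Suc L = (1 + norm (Complex c t)) powr real (Suc L)"
      by (rule powr_realpow[symmetric]) (auto intro: add_pos_nonneg)
    finally show ?thesis .
  qed
  define g where "g h t = h (Complex c t) * test_kernel p q (of_real \<epsilon> * Complex c t) * exp (of_real (lam n) * Complex c t)"
    for h :: "complex \<Rightarrow> complex" and t
  define B where "B = M * (8 * real q) ^ (2 * q) * (1 / \<epsilon>) powr real (Suc L) * exp ((lam n + \<epsilon>) * c)"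
  have sym: "test_kernel p q z = test_kernel q p z" for z
    by (simp add: test_kernel_def mult.commute)
  have dom: "norm (g (riesz_mean lam (real L) D (real (Suc N))) t) \<le> B * (1 / (1 + (\<epsilon> * t)\<^sup>2))" for N t
    unfolding g_def sym B_def
    using tempered_kernel_bound[OF \<epsilon>' q p, of "real (Suc L)" "Complex c t"
        "riesz_mean lam (real L) D (real (Suc N)) (Complex c t)" M "lam n"] mean_le[of "real (Suc N)" t] M c L(1)
    by (simp add: q_def)
  have hol_mean: "riesz_mean lam (real L) D x holomorphic_on UNIV" for x
    unfolding riesz_mean_def[abs_def] by (intro holomorphic_intros)
  have g_meas: "g h \<in> borel_measurable lborel" if "h holomorphic_on half_plane 0" for h
  proof -
    have "continuous_on UNIV (g h)"
      unfolding g_def using p q c that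
      by (intro continuous_on_vertical_line[where S = "half_plane 0"] test_kernel_holomorphic holomorphic_intros)
         (auto simp: half_plane_zero)
    then show ?thesis using borel_measurable_continuous_onI by simp
  qed
  have "(\<lambda>N. LINT t|lborel. g (riesz_mean lam (real L) D (real (Suc N))) t) \<longlonglongrightarrow> (LINT t|lborel. g f t)"
  proof (rule integral_dominated_convergence[where w = "\<lambda>t. B * (1 / (1 + (\<epsilon> * t)\<^sup>2))"])
    show "g f \<in> borel_measurable lborel" by (rule g_meas[OF hol])
    show "g (riesz_mean lam (real L) D (real (Suc N))) \<in> borel_measurable lborel" for N
      by (rule g_meas) (rule holomorphic_on_subset[OF hol_mean], simp)
    show "integrable lborel (\<lambda>t. B * (1 / (1 + (\<epsilon> * t)\<^sup>2)))"
      by (intro integrable_mult_right integral_inverse_scaled_square \<epsilon>')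
    show "AE t in lborel. (\<lambda>N. g (riesz_mean lam (real L) D (real (Suc N))) t) \<longlonglongrightarrow> g f t"
      unfolding g_def by (intro AE_I2 tendsto_mult_right raise(1)) (simp add: c_def)
  qed (intro AE_I2 dom)
  moreover have "(\<lambda>N. LINT t|lborel. g (riesz_mean lam (real L) D (real (Suc N))) t) \<longlonglongrightarrow> D n * kernel_mass p q \<epsilon>"
  proof -
    have "(\<lambda>N. of_real ((1 - lam n / real (Suc N)) ^ L) :: complex) \<longlonglongrightarrow> of_real ((1 - 0) ^ L)"
      by (intro tendsto_intros) real_asymp
    then have "(\<lambda>N. D n * of_real ((1 - lam n / real (Suc N)) ^ L) * kernel_mass p q \<epsilon>) \<longlonglongrightarrow> D n * of_real ((1 - 0) ^ L) * kernel_mass p q \<epsilon>"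
      by (intro tendsto_mult_left tendsto_mult_right)
    moreover have "eventually (\<lambda>N. D n * of_real ((1 - lam n / real (Suc N)) ^ L) * kernel_mass p q \<epsilon> =
        (LINT t|lborel. g (riesz_mean lam (real L) D (real (Suc N))) t)) sequentially"
      using eventually_ge_at_top[of "nat \<lceil>lam n\<rceil>"]
    proof eventually_elim
      case (elim N)
      then have x: "lam n \<le> real (Suc N)" by linarith
      then have "n \<in> freq_upto lam (real (Suc N))" using n by (simp add: freq_upto_def)
      from integral_riesz_mean_test_kernel[OF lam this \<epsilon> p q, of c "real L" D]
      show ?case
        unfolding g_def using c x riesz_weight_of_nat[OF L(1), of "1 - lam n / real (Suc N)"] by simp
    qed
    ultimately show ?thesis using Lim_transform_eventually by fastforce
  qed
  ultimately have "(LINT t|lborel. g f t) = D n * kernel_mass p q \<epsilon>"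
    by (rule LIMSEQ_unique)
  then show ?thesis using q c unfolding g_def by blast
qed

text \<open>The integral representation is moved from the line \<open>Re s = c\<close> to \<open>Re s = \<delta>\<close>, estimated there
  with the growth bound, and \<open>\<delta>\<close> tends to zero. Dividing by the kernel mass, which is at least
  \<open>1 / \<epsilon>\<close>, cancels the factor \<open>1 / \<epsilon>\<close> from the substitution \<open>t \<mapsto> \<epsilon> t\<close>.\<close>
lemma coefficient_bound:
  assumes lam: "frequency lam" and n: "n \<ge> 1" and ext: "is_limit_extension lam D f"
    and k: "0 \<le> k" "k + 2 \<le> real (2 * p)" and M: "M \<ge> 0"
    and f: "\<And>s. 0 < Re s \<Longrightarrow> norm (f s) \<le> M * (1 + norm s) powr k"
  shows "norm (D n) \<le> (8 * real p) ^ (2 * p) * (LINT t|lborel. 1 / (1 + t\<^sup>2)) * M * (1 / eps lam n) powr k"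
proof -
  define \<epsilon> where "\<epsilon> = eps lam n"
  define I where "I = (LINT t|lborel. 1 / (1 + t\<^sup>2 :: real))"
  define A where "A = M * (8 * real p) ^ (2 * p) * (1 / \<epsilon>) powr k"
  have A: "A \<ge> 0" using M by (simp add: A_def)
  have \<epsilon>: "0 < \<epsilon>" "\<epsilon> \<le> 1" using eps_pos[OF lam n] \<epsilon>_def by auto
  have p: "p > 0" using k by (cases p) auto
  obtain q c where q: "q > 0" and c: "c > 0"
    and rep: "(LINT t|lborel. f (Complex c t) * test_kernel p q (of_real \<epsilon> * Complex c t)
            * exp (of_real (lam n) * Complex c t)) = D n * kernel_mass p q \<epsilon>"
    using coefficient_integral_representation[OF lam n ext p \<epsilon>_def] by blast
  define g where "g s = f s * test_kernel p q (of_real \<epsilon> * s) * exp (of_real (lam n) * s)" for s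
  have lam0: "lam n \<ge> 0" using lam n by (simp add: frequency_def)
  have hol: "f holomorphic_on {s. 0 < Re s}"
    using ext by (simp add: is_limit_extension_def half_plane_zero)
  have g_hol: "g holomorphic_on {s. 0 < Re s}"
    unfolding g_def by (intro holomorphic_intros hol test_kernel_holomorphic p q)
  have g_le: "norm (g s) \<le> A * exp ((lam n + \<epsilon>) * Re s) * (1 / (1 + (\<epsilon> * Im s)\<^sup>2))" if "0 < Re s" for s
    using tempered_kernel_bound[OF \<epsilon> p q k, of s "f s" M "lam n"] f[OF that] that M
    by (simp add: g_def A_def)
  have near: "norm (D n) \<le> A * I * exp ((lam n + \<epsilon>) * \<delta>)" if \<delta>: "0 < \<delta>" "\<delta> \<le> c" for \<delta>
  proof -
    have "(LINT t|lborel. g (Complex \<delta> t)) = (LINT t|lborel. g (Complex c t))"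
    proof (rule vertical_line_shift[OF _ _ g_hol])
      show "open {s. 0 < Re s}" by (rule open_halfspace_Re_gt)
      show "convex {s. 0 < Re s}" by (rule convex_halfspace_Re_gt)
      fix s assume "min \<delta> c \<le> Re s" "Re s \<le> max \<delta> c"
      then have s: "0 < Re s" "Re s \<le> c" using \<delta> by auto
      have "norm (g s) \<le> A * exp ((lam n + \<epsilon>) * Re s) * (1 / (1 + (\<epsilon> * Im s)\<^sup>2))"
        by (rule g_le[OF s(1)])
      also have "\<dots> \<le> A * exp ((lam n + \<epsilon>) * c) * ((1 / \<epsilon>\<^sup>2) / (1 + (Im s)\<^sup>2))"
        using A s lam0 \<epsilon>
        by (intro mult_mono mult_left_mono inverse_scaled_square_le) (auto intro!: mult_left_mono)
      finally have "norm (g s) \<le> A * exp ((lam n + \<epsilon>) * c) * (1 / \<epsilon>\<^sup>2) / (1 + (Im s)\<^sup>2)" by simp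
      then show "s \<in> {s. 0 < Re s} \<and> norm (g s) \<le> A * exp ((lam n + \<epsilon>) * c) * (1 / \<epsilon>\<^sup>2) / (1 + (Im s)\<^sup>2)"
        using s by simp
    qed
    then have eq: "(LINT t|lborel. g (Complex \<delta> t)) = D n * kernel_mass p q \<epsilon>"
      using rep by (simp only: g_def)
    have g_\<delta>: "norm (g (Complex \<delta> t)) \<le> A * exp ((lam n + \<epsilon>) * \<delta>) * (1 / (1 + (\<epsilon> * t)\<^sup>2))" for t
      using g_le[of "Complex \<delta> t"] \<delta> by simp
    have int: "integrable lborel (\<lambda>t. A * exp ((lam n + \<epsilon>) * \<delta>) * (1 / (1 + (\<epsilon> * t)\<^sup>2)))"
      by (intro integrable_mult_right integral_inverse_scaled_square \<epsilon>)
    have "norm (LINT t|lborel. g (Complex \<delta> t)) \<le> (LINT t|lborel. A * exp ((lam n + \<epsilon>) * \<delta>) * (1 / (1 + (\<epsilon> * t)\<^sup>2)))"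
    proof (rule Bochner_Integration.integral_norm_bound_integral[OF _ int g_\<delta>])
      have "continuous_on UNIV (\<lambda>t. g (Complex \<delta> t))"
        by (rule continuous_on_vertical_line[OF g_hol]) (use \<delta> in simp)
      then have "(\<lambda>t. g (Complex \<delta> t)) \<in> borel_measurable lborel"
        using borel_measurable_continuous_onI by simp
      then show "integrable lborel (\<lambda>t. g (Complex \<delta> t))"
        by (rule Bochner_Integration.integrable_bound[OF int])
           (intro AE_I2 order_trans[OF g_\<delta>], simp only: real_norm_def abs_ge_self)
    qed
    also have "\<dots> = A * exp ((lam n + \<epsilon>) * \<delta>) * (I / \<epsilon>)"
      unfolding I_def integral_inverse_scaled_square(2)[OF \<epsilon>(1), symmetric] by (rule integral_mult_right_zero)
    finally have upper: "norm (D n) * norm (kernel_mass p q \<epsilon>) \<le> A * exp ((lam n + \<epsilon>) * \<delta>) * (I / \<epsilon>)"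
      unfolding eq norm_mult .
    have "norm (D n) * (1 / \<epsilon>) \<le> norm (D n) * norm (kernel_mass p q \<epsilon>)"
      by (intro mult_left_mono norm_kernel_mass_ge p q \<epsilon> norm_ge_zero)
    also note upper
    finally have "norm (D n) * (1 / \<epsilon>) * \<epsilon> \<le> A * exp ((lam n + \<epsilon>) * \<delta>) * (I / \<epsilon>) * \<epsilon>"
      using \<epsilon> by (intro mult_right_mono) auto
    then show ?thesis using \<epsilon> by (simp add: mult_ac)
  qed
  have "(\<lambda>j. A * I * exp ((lam n + \<epsilon>) * (c / real (Suc j)))) \<longlonglongrightarrow> A * I * exp ((lam n + \<epsilon>) * 0)"
  proof (intro tendsto_intros)
    have "(\<lambda>j. 1 / real (Suc j)) \<longlonglongrightarrow> 0" by real_asymp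
    from tendsto_mult_right_zero[OF this, of c]
    show "(\<lambda>j. c / real (Suc j)) \<longlonglongrightarrow> 0" by simp
  qed
  moreover have "norm (D n) \<le> A * I * exp ((lam n + \<epsilon>) * (c / real (Suc j)))" for j
    using c by (intro near) (auto simp: divide_le_eq mult_le_cancel_left1)
  ultimately have "norm (D n) \<le> A * I * exp ((lam n + \<epsilon>) * 0)"
    by (intro LIMSEQ_le_const) auto
  then show ?thesis by (simp add: A_def I_def \<epsilon>_def mult_ac)
qed

theorem theorem5p1:
  fixes lam :: "nat \<Rightarrow> real" and k :: real
  assumes "frequency lam" and "k \<ge> 0"
  shows "\<exists>C>0. \<forall>D \<in> D_ext lam k. \<forall>n\<ge>1.
           norm (D n) \<le> C * D_ext_norm lam k D * (1 / eps lam n) powr k"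
proof -
  \<comment> \<open>decay of order \<open>k + 2\<close> absorbs the growth of the limit function and leaves an integrable square\<close>
  define p where "p = nat \<lceil>k\<rceil> + 1"
  have "k \<le> real (nat \<lceil>k\<rceil>)" by (rule real_nat_ceiling_ge)
  moreover have "real (2 * p) = 2 * real (nat \<lceil>k\<rceil>) + 2" by (simp only: p_def of_nat_mult of_nat_add) simp
  ultimately have p: "k + 2 \<le> real (2 * p)" using assms(2) by linarith
  \<comment> \<open>the summand 1 only ensures that the constant is positive\<close>
  define C where "C = (8 * real p) ^ (2 * p) * (LINT t|lborel. 1 / (1 + t\<^sup>2)) + 1"
  have C: "C > 0"
    unfolding C_def by (intro add_nonneg_pos mult_nonneg_nonneg integral_nonneg_AE) auto
  have "norm (D n) \<le> C * D_ext_norm lam k D * (1 / eps lam n) powr k"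
    if D: "D \<in> D_ext lam k" and n: "n \<ge> 1" for D n
  proof -
    define f where "f = limit_fun lam D"
    define M where "M = D_ext_norm lam k D"
    have ext: "is_limit_extension lam D f"
      unfolding f_def limit_fun_def using D someI_ex[of "is_limit_extension lam D"] by (auto simp: D_ext_def)
    have bdd: "bdd_above ((\<lambda>s. norm (f s) / (1 + norm s) powr k) ` half_plane 0)"
      using D by (simp add: D_ext_def f_def)
    have quot: "norm (f s) / (1 + norm s) powr k \<le> M" if "0 < Re s" for s
      unfolding M_def D_ext_norm_def f_def[symmetric]
      by (rule cSUP_upper[OF _ bdd]) (use that in \<open>simp add: half_plane_zero\<close>)
    have M: "M \<ge> 0"
      by (rule order_trans[OF _ quot[of 1]]) auto
    have f_le: "norm (f s) \<le> M * (1 + norm s) powr k" if "0 < Re s" for s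
    proof -
      have "1 + norm s > 0" by (intro add_pos_nonneg) auto
      then show ?thesis using quot[OF that] by (simp add: pos_divide_le_eq)
    qed
    have "norm (D n) \<le> (8 * real p) ^ (2 * p) * (LINT t|lborel. 1 / (1 + t\<^sup>2)) * M * (1 / eps lam n) powr k"
      by (rule coefficient_bound[OF assms(1) n ext assms(2) p M f_le])
    also have "\<dots> \<le> C * M * (1 / eps lam n) powr k"
      using M by (intro mult_right_mono) (auto simp: C_def)
    finally show ?thesis by (simp only: M_def)
  qed
  with C show ?thesis by blast
qed

end
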